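(* There exists an absolute constant $c>0$ such that the following holds. Let $D$ be any distribution on $\{-1,1\}^n$ such that $\sum_{i=1}^n D_i$ takes at most $k$ distinct values. For any $\rho\in(0,1]$, there is some $t$ such that \[ \Big|\Pr[B\ge t]-\Pr\Big[\sum_{i=1}^n (D\cdot N_\rho)_i\ge t\Big]\Big|\;\ge\;2^{-ck/\rho}. \]
   Context: $U$ is uniform on $\{-1,1\}^n$ and $B:=\sum_{i=1}^n U_i$. $N_\rho$ is the distribution on $\{-1,1\}^n$ in which each coordinate is independently set to a uniform random bit with probability $1-\rho$ and to $1$ otherwise; $D\cdot N_\rho$ is the coordinate-wise product of independent samples of $D$ and $N_\rho$.
   Formalization: The condition k ≤ n is added: for k ≥ n+1 every D qualifies, and D uniform on {-1,1}^n makes D·N_ρ uniform, so the difference is 0 for every t and the claim fails. *)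

theory Defs
  imports "HOL-Probability.Probability"
begin

text \<open>
  The dimension n is bound inside the main statement (after the absolute constant), so points of
  the cube are functions on the index set \<open>{..<n}\<close>, extended by \<^term>\<open>undefined\<close> outside of it.
\<close>

definition cube :: "nat \<Rightarrow> (nat \<Rightarrow> int) set" where
  "cube n = {..<n} \<rightarrow>\<^sub>E {-1, 1}"

definition uniform_cube :: "nat \<Rightarrow> (nat \<Rightarrow> int) pmf" where
  "uniform_cube n = pmf_of_set (cube n)"

definition coord_sum :: "nat \<Rightarrow> (nat \<Rightarrow> int) \<Rightarrow> int" where
  "coord_sum n x = (\<Sum>i<n. x i)"

definition noise_bit :: "real \<Rightarrow> int pmf" where
  "noise_bit \<rho> =
     bind_pmf (bernoulli_pmf (1 - \<rho>)) (\<lambda>b. if b then pmf_of_set {-1, 1} else return_pmf 1)"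

definition noise :: "nat \<Rightarrow> real \<Rightarrow> (nat \<Rightarrow> int) pmf" where
  "noise n \<rho> = Pi_pmf {..<n} undefined (\<lambda>_. noise_bit \<rho>)"

definition cube_mult :: "nat \<Rightarrow> (nat \<Rightarrow> int) pmf \<Rightarrow> (nat \<Rightarrow> int) pmf \<Rightarrow> (nat \<Rightarrow> int) pmf" where
  "cube_mult n D E = map_pmf (\<lambda>(x, y). \<lambda>i\<in>{..<n}. x i * y i) (pair_pmf D E)"

end

theory Submission
  imports Defs
begin

text \<open>
  Let $s_1, \dots, s_k$ be the values of $\sum_i D_i$ and let \<open>B\<close> be the sum of a uniform point. If
  $\tan\varphi = \rho\tan\theta$, then the characteristic function at \<open>\<theta>\<close> of the noisy version of a
  distribution on the cube is $(\cos\theta/\cos\varphi)^n$ times that of the original at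
  $\varphi$, and noise leaves the uniform distribution fixed. So if the two threshold functions
  differ by at most $\delta$, the characteristic functions of $\sum_i D_i$ and of \<open>B\<close> differ at
  $|\varphi| \le \sqrt{k\rho/n}$ by roughly $\delta e^{O(k/\rho)}$; the part of the difference
  that comes from $|B| \gg \sqrt{nk/\rho}$ is absorbed by Hoeffding's inequality.

  On the other hand, with $h \approx \sqrt{\rho/(nk)}$ the trigonometric polynomial
  $H(s) = \prod_j |e^{ihs} - e^{ihs_j}|^2$ only has frequencies up to $kh$ and coefficients of total weight
  at most $4^k$. It vanishes on the support of $\sum_i D_i$, but its expectation under \<open>B\<close> is at least
  $e^{-O(k/\rho)}$: a monic polynomial of degree \<open>k\<close> cannot be small at $k + 1$ well separated points,
  and the \<open>k + 1\<close> points can be picked in binomial cells of width about $\sqrt{n/k}$.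
\<close>

section \<open>Lower bounds for binomial coefficients\<close>

text \<open>Passing from m to m + 1 multiplies the right side by 16 (2m + 1)^2 / (4m(m + 1)), which
  is at least 16. Squaring the bound C(2m, m) \<ge> 4^m / (2 sqrt m) keeps the induction free of
  roots.\<close>

lemma central_binomial_ge: "16 ^ m \<le> (real (2 * m choose m))\<^sup>2 * (4 * real m)" if "m > 0"
  using that
proof (induction m rule: nat_induct_non_zero)
  case 1
  then show ?case by (simp add: power2_eq_square)
next
  case (Suc m)
  define c where "c = real (2 * m choose m)"
  have rec: "real (2 * Suc m choose Suc m) * (real m + 1) = 2 * (2 * real m + 1) * c"
  proof -
    have "Suc m * (Suc (Suc (2 * m)) choose Suc m) = Suc (Suc (2 * m)) * (Suc (2 * m) choose m)"
      using Suc_times_binomial_eq[of "Suc (2 * m)" m] by (simp add: mult.commute del: binomial_Suc_Suc)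
    moreover have "Suc m * (Suc (2 * m) choose Suc m) = Suc (2 * m) * (2 * m choose m)"
      using Suc_times_binomial_eq[of "2 * m" m] by (simp add: mult.commute del: binomial_Suc_Suc)
    moreover have "(Suc (2 * m) choose Suc m) = (Suc (2 * m) choose m)"
      by (subst binomial_symmetric) (auto)
    ultimately have "Suc m * (Suc m * (2 * Suc m choose Suc m)) = Suc m * (2 * (Suc (2 * m) * (2 * m choose m)))"
      by (simp add: algebra_simps)
    then have "Suc m * (2 * Suc m choose Suc m) = 2 * (Suc (2 * m) * (2 * m choose m))"
      by (metis mult_left_cancel nat.simps(3))
    then have "real (Suc m * (2 * Suc m choose Suc m)) = real (2 * (Suc (2 * m) * (2 * m choose m)))"
      by (simp only:)
    then show ?thesis by (simp add: c_def algebra_simps)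
  qed
  have "16 ^ Suc m * (real m + 1)\<^sup>2 \<le> 16 * (c\<^sup>2 * (4 * real m)) * (real m + 1)\<^sup>2"
    using Suc by (intro mult_right_mono) (auto simp: c_def algebra_simps)
  also have "\<dots> = (2 * c)\<^sup>2 * (4 * (real m + 1)) * (4 * real m * (real m + 1))"
    by (simp add: power2_eq_square algebra_simps)
  also have "\<dots> \<le> (2 * c)\<^sup>2 * (4 * (real m + 1)) * (2 * real m + 1)\<^sup>2"
    by (intro mult_left_mono mult_nonneg_nonneg, simp add: power2_eq_square algebra_simps) auto
  also have "\<dots> = (2 * (2 * real m + 1) * c)\<^sup>2 * (4 * (real m + 1))"
    by (simp add: power2_eq_square algebra_simps)
  also have "\<dots> = (real (2 * Suc m choose Suc m))\<^sup>2 * (4 * real (Suc m)) * (real m + 1)\<^sup>2"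
    unfolding rec [symmetric] by (simp add: power2_eq_square algebra_simps)
  finally show ?case
    by (rule mult_right_le_imp_le) simp
qed

text \<open>For even n this is the central coefficient. For odd n = 2m + 1, Pascal's rule writes the
  central coefficient of 2m + 2 as the sum of the two equal middle coefficients of n.\<close>

lemma middle_binomial_ge:
  assumes "n > 0"
  shows "2 ^ n \<le> 3 * sqrt n * real (n choose ((n + 1) div 2))"
proof -
  have even: "2 ^ (2 * m) \<le> 2 * sqrt m * real (2 * m choose m)" if "m > 0" for m
  proof -
    have "(2 ^ (2 * m))\<^sup>2 = (4 ^ m * 4 ^ m :: real)"
      by (simp add: power_mult power2_eq_square)
    also have "\<dots> = 16 ^ m"
      by (simp flip: power_mult_distrib)
    also have "\<dots> \<le> (2 * sqrt m * real (2 * m choose m))\<^sup>2"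
      using central_binomial_ge[OF that] by (simp add: power_mult_distrib algebra_simps)
    finally show ?thesis
      by (rule power2_le_imp_le) simp
  qed
  show ?thesis
  proof (cases "even n")
    case True
    then obtain m where m: "n = 2 * m" by blast
    have "(2::real) ^ n \<le> 2 * sqrt m * real (2 * m choose m)"
      using even[of m] assms m by simp
    also have "\<dots> \<le> 3 * sqrt n * real (2 * m choose m)"
      using m by (intro mult_right_mono mult_mono) auto
    finally show ?thesis using m by simp
  next
    case False
    then obtain m where m: "n = 2 * m + 1" using oddE by blast
    have sym: "(n choose m) = (n choose Suc m)"
      using m by (subst binomial_symmetric) auto
    have "2 * (2::real) ^ n = 2 ^ (2 * Suc m)"
      using m by simp
    also have "\<dots> \<le> 2 * sqrt (Suc m) * real (2 * Suc m choose Suc m)"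
      by (rule even) simp
    also have "real (2 * Suc m choose Suc m) = 2 * real (n choose Suc m)"
      using m sym by simp
    also have "2 * sqrt (Suc m) * (2 * real (n choose Suc m)) \<le> 2 * (3 * sqrt n * real (n choose Suc m))"
    proof -
      have "sqrt (Suc m) * 2 \<le> 3 * sqrt n"
        using m by (intro order_trans[OF mult_mono[of "sqrt (Suc m)" "sqrt n" 2 3]]) auto
      from mult_right_mono[OF this, of "2 * real (n choose Suc m)"] show ?thesis
        by (simp add: algebra_simps del: binomial_Suc_Suc)
    qed
    finally show ?thesis using m by simp
  qed
qed

text \<open>With $d = 2w - n$, each step to the right of the middle multiplies the coefficient by
  $(n - d)/(n + d + 2) \ge \exp(-(4d + 8)/n)$, as long as $d \le n/2$; the exponents telescope to $(d + 1)^2/n$.\<close>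

lemma binomial_ge_middle:
  assumes "n > 0" "n \<le> 2 * w" "2 * (2 * w - n) \<le> n + 4"
  shows "real (n choose ((n + 1) div 2)) * exp (- ((real (2 * w - n) + 1)\<^sup>2 / n)) \<le> real (n choose w)"
proof -
  define m where "m = (n + 1) div 2"
  have "m \<le> w" using assms m_def by simp
  then show ?thesis
    using assms(3)
  proof (induction w rule: dec_induct)
    case base
    then show ?case unfolding m_def[symmetric] by (simp add: mult_left_le)
  next
    case (step w)
    define d where "d = real (2 * w - n)"
    have mw: "n \<le> 2 * w" using step m_def by simp
    have d: "d = 2 * real w - real n" using mw by (simp add: d_def of_nat_diff)
    have d0: "d \<ge> 0" by (simp add: d_def)
    \<comment> \<open>The allowance \<open>n + 4\<close> at \<open>Suc w\<close> is exactly
      \<open>2 * d \<le> n\<close> at \<open>w\<close>, because \<open>d\<close> grows by 2 per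
      step.\<close>
    have dn: "2 * d \<le> real n" 
    proof -
      have "2 * (2 * w - n) \<le> n" using step.prems mw by arith
      then show ?thesis unfolding d_def by linarith
    qed
    have wn: "w < n" using dn d assms(1) by simp
    have le: "(real n + d + 2) * exp (- ((4 * d + 8) / n)) \<le> real n - d"
    proof -
      have nd: "real n - d > 0" using dn assms(1) by simp
      have "(real n + d + 2) / (real n - d) = 1 + (2 * d + 2) / (real n - d)"
        using nd by (simp add: field_simps)
      also have "\<dots> \<le> exp ((2 * d + 2) / (real n - d))"
        by (rule exp_ge_add_one_self)
      also have "(2 * d + 2) / (real n - d) \<le> (4 * d + 8) / n"
      proof -
        have "(2 * d + 2) / (real n - d) \<le> (2 * d + 2) / (real n / 2)"
          using dn nd d0 assms(1) by (intro divide_left_mono) auto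
        also have "\<dots> \<le> (4 * d + 8) / n" using assms(1) by (simp add: field_simps)
        finally show ?thesis .
      qed
      finally have "(real n + d + 2) / (real n - d) \<le> exp ((4 * d + 8) / n)" by simp
      then have "real n + d + 2 \<le> exp ((4 * d + 8) / n) * (real n - d)"
        using nd by (simp add: field_simps)
      then show ?thesis
        by (simp add: exp_minus field_simps)
    qed
    \<comment> \<open>The quotient of the two coefficients is (n - w)/(w + 1); doubled, numerator
      and denominator are n - d and n + d + 2.\<close>
    have ratio: "real (n choose Suc w) * (real n + d + 2) = real (n choose w) * (real n - d)"
    proof -
      have "(n choose Suc w) * Suc w = (n choose w) * (n - w)"
        by (metis binomial_absorb_comp binomial_absorption mult.commute Suc_diff_1 assms(1) diff_Suc_1' One_nat_def)
      then have "real (n choose Suc w) * real (Suc w) = real (n choose w) * real (n - w)"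
        by (metis of_nat_mult)
      then show ?thesis using wn unfolding d by (simp add: of_nat_diff algebra_simps)
    qed
    have IH: "real (n choose m) * exp (- ((d + 1)\<^sup>2 / n)) \<le> real (n choose w)"
      using step mw unfolding m_def d_def by simp
    have dS: "real (2 * Suc w - n) = d + 2" using mw unfolding d by (simp add: of_nat_diff)
    have "real (n choose m) * exp (- ((d + 3)\<^sup>2 / n)) * (real n + d + 2)
        = real (n choose m) * exp (- ((d + 1)\<^sup>2 / n)) * ((real n + d + 2) * exp (- ((4 * d + 8) / n)))"
    proof -
      have "- ((d + 3)\<^sup>2 / n) = - ((d + 1)\<^sup>2 / n) + (- ((4 * d + 8) / n))"
        using assms(1) by (simp add: field_simps power2_eq_square)
      then show ?thesis by (simp only: exp_add) (simp add: algebra_simps)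
    qed
    also have "\<dots> \<le> real (n choose w) * (real n - d)"
      using IH le d0 by (intro mult_mono) auto
    also have "\<dots> = real (n choose Suc w) * (real n + d + 2)" using ratio by simp
    finally have "real (n choose m) * exp (- ((d + 3)\<^sup>2 / n)) \<le> real (n choose Suc w)"
      by (rule mult_right_le_imp_le) (use d0 in auto)
    then show ?case unfolding dS m_def by (simp add: add.assoc)
  qed
qed

text \<open>Near the middle the product estimate applies. Farther out, \<open>D + 1\<close> is at
  least n/2, and the factor 4 in the exponent makes the exponential at most e^(-n), so that the left
  side is at most 1 and any nonzero coefficient suffices. The left half follows by symmetry.\<close>

lemma binomial_ge_gaussian:
  assumes n: "n > 0" and w: "w \<le> n" and D: "\<bar>2 * real w - real n\<bar> \<le> D"
  shows "2 ^ n * exp (- (4 * (D + 1)\<^sup>2 / n)) \<le> 3 * sqrt n * real (n choose w)"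
proof -
  have main: "2 ^ n * exp (- (4 * (D + 1)\<^sup>2 / n)) \<le> 3 * sqrt n * real (n choose w)"
    if w: "w \<le> n" "n \<le> 2 * w" and D: "2 * real w - real n \<le> D" for w
  proof (cases "2 * (2 * w - n) \<le> n + 4")
    case True
    have "(real (2 * w - n) + 1)\<^sup>2 \<le> (D + 1)\<^sup>2"
      using w D by (intro power_mono) (auto simp: of_nat_diff)
    then have le: "(real (2 * w - n) + 1)\<^sup>2 / n \<le> 4 * (D + 1)\<^sup>2 / n"
      by (intro divide_right_mono) (smt (verit) zero_le_power2, simp)
    have "2 ^ n * exp (- (4 * (D + 1)\<^sup>2 / n)) \<le>
        (3 * sqrt n * real (n choose ((n + 1) div 2))) * exp (- ((real (2 * w - n) + 1)\<^sup>2 / n))"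
      using middle_binomial_ge[OF n] le by (intro mult_mono) auto
    also have "\<dots> \<le> 3 * sqrt n * real (n choose w)"
      using mult_left_mono[OF binomial_ge_middle[OF n w(2) True], of "3 * sqrt n"]
      by (simp add: mult.assoc)
    finally show ?thesis .
  next
    case False
    then have "real n / 2 \<le> D + 1"
      using D w by linarith
    then have "(real n / 2)\<^sup>2 \<le> (D + 1)\<^sup>2" by (intro power_mono) auto
    then have "real n \<le> 4 * (D + 1)\<^sup>2 / n"
      using n by (simp add: field_simps power2_eq_square)
    then have "exp (- (4 * (D + 1)\<^sup>2 / n)) \<le> exp (- real n)" by simp
    also have "\<dots> = (exp (-1)) ^ n" by (simp add: exp_of_nat_mult [symmetric])
    also have "\<dots> \<le> (1 / 2) ^ n"
      using exp_ge_add_one_self[of 1] by (intro power_mono) (auto simp: exp_minus field_simps)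
    finally have "2 ^ n * exp (- (4 * (D + 1)\<^sup>2 / n)) \<le> 1" by (simp add: field_simps)
    also have "1 \<le> 3 * sqrt n * real (n choose w)"
    proof -
      have "1 \<le> real (n choose w)" using w by (simp add: Suc_le_eq zero_less_binomial)
      moreover have "1 \<le> 3 * sqrt n" using n by (smt (verit) real_sqrt_ge_one of_nat_1 of_nat_le_iff Suc_leI One_nat_def)
      ultimately show ?thesis using mult_mono[of 1 "3 * sqrt n" 1 "real (n choose w)"] by simp
    qed
    finally show ?thesis .
  qed
  show ?thesis
  proof (cases "n \<le> 2 * w")
    case True
    then show ?thesis using main w D by simp
  next
    case False
    then have "2 ^ n * exp (- (4 * (D + 1)\<^sup>2 / n)) \<le> 3 * sqrt n * real (n choose (n - w))"
      using w D by (intro main) (auto simp: of_nat_diff)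
    then show ?thesis using w by (simp add: binomial_symmetric [symmetric])
  qed
qed

section \<open>Characteristic functions of integer distributions\<close>

definition char_sum :: "int pmf \<Rightarrow> real \<Rightarrow> complex" where
  "char_sum p \<theta> = measure_pmf.expectation p (\<lambda>s. cis (\<theta> * of_int s))"

lemma norm_cis_diff: "norm (cis a - cis b) = 2 * \<bar>sin ((a - b) / 2)\<bar>"
proof -
  have "(norm (cis a - cis b))\<^sup>2 = (cos a - cos b)\<^sup>2 + (sin a - sin b)\<^sup>2"
    by (simp add: cmod_power2)
  also have "\<dots> = ((sin a)\<^sup>2 + (cos a)\<^sup>2) + ((sin b)\<^sup>2 + (cos b)\<^sup>2) - 2 * cos (a - b)"
    by (simp add: power2_eq_square algebra_simps cos_diff)
  also have "\<dots> = (2 * \<bar>sin ((a - b) / 2)\<bar>)\<^sup>2"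
  proof -
    have "2 * ((a - b) / 2) = a - b" by simp
    from cos_double_sin[of "(a - b) / 2", unfolded this] show ?thesis
      by (simp add: power_mult_distrib)
  qed
  finally show ?thesis
    by (rule power2_eq_imp_eq) auto
qed

lemma norm_cis_diff_le: "norm (cis a - cis b) \<le> \<bar>a - b\<bar>"
  using abs_sin_x_le_abs_x[of "(a - b) / 2"] by (simp add: norm_cis_diff)

lemma norm_add_diff_le: "norm (x + y - z) \<le> norm x + norm y + norm z"
  for x y z :: "'a :: real_normed_vector"
  using norm_triangle_ineq4[of "x + y" z] norm_triangle_ineq[of x y] by linarith

text \<open>Summation by parts. After clamping s to [-R, R], the exponential is a constant plus 2R
  threshold indicators with coefficients of size at most |\<theta>|, which costs
  2R|\<theta>|\<delta>. Clamping costs twice the tail of each distribution, and the tail of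
  \<open>q\<close> is traded for that of \<open>p\<close> plus 2\<delta>.\<close>

lemma norm_char_sum_diff_le:
  fixes p q :: "int pmf" and R :: nat
  assumes pq: "\<And>r. \<bar>measure_pmf.prob p {s. s \<ge> r} - measure_pmf.prob q {s. s \<ge> r}\<bar> \<le> \<delta>"
  shows "norm (char_sum p \<theta> - char_sum q \<theta>)
           \<le> \<delta> * (2 * real R * \<bar>\<theta>\<bar> + 4) + 4 * measure_pmf.prob p {s. \<bar>s\<bar> > int R}"
proof -
  let ?E = "\<lambda>p f. measure_pmf.expectation p f"
  define f :: "int \<Rightarrow> complex" where "f s = cis (\<theta> * of_int s)" for s
  define c where "c s = max (- int R) (min (int R) s)" for s
  define P where "P p r = measure_pmf.prob p {s. s \<ge> r}" for p :: "int pmf" and r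
  define T where "T p = measure_pmf.prob p {s. \<bar>s\<bar> > int R}" for p :: "int pmf"
  have step: "norm (f r - f (r - 1)) \<le> \<bar>\<theta>\<bar>" for r
    using norm_cis_diff_le[of "\<theta> * of_int r" "\<theta> * of_int (r - 1)"]
    by (simp add: f_def algebra_simps)
  \<comment> \<open>The upper clamp is the variable \<open>int m - int R\<close>, so that induction
    on \<open>m\<close> adds one threshold at a time; \<open>m = 2 * R\<close> gives
    \<open>c\<close>.\<close>
  have tele: "f (max (- int R) (min (int m - int R) s)) =
      f (- int R) + (\<Sum>j\<in>{1..m}. (f (int j - int R) - f (int j - int R - 1)) * indicator {s. s \<ge> int j - int R} s)" for m s
  proof (induction m)
    case 0
    then show ?case by (auto simp: max_def min_def)
  next
    case (Suc m)
    show ?case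
    proof (cases "s \<ge> int (Suc m) - int R")
      case True
      then have "min (int (Suc m) - int R) s = int (Suc m) - int R" "min (int m - int R) s = int m - int R"
        by auto
      then show ?thesis using True Suc by (simp add: indicator_def)
    next
      case False
      then have "min (int (Suc m) - int R) s = min (int m - int R) s" by (auto simp: min_def)
      then show ?thesis using False Suc by (simp add: indicator_def)
    qed
  qed
  have clamp: "f (c s) = f (- int R) +
     (\<Sum>j\<in>{1..2*R}. (f (int j - int R) - f (int j - int R - 1)) * indicator {s. s \<ge> int j - int R} s)" for s
    using tele[of "2 * R" s] by (simp add: c_def)
  have int_ind: "integrable (measure_pmf p) (\<lambda>s. z * indicator A s)" for p :: "int pmf" and z :: complex and A
    by (intro measure_pmf.integrable_const_bound[where B = "norm z"]) (auto simp: indicator_def)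
  have E_ind: "?E p (\<lambda>s. z * indicator A s) = z * of_real (measure_pmf.prob p A)" for p :: "int pmf" and z :: complex and A
  proof -
    have "?E p (\<lambda>s. z * indicator A s) = ?E p (\<lambda>s. z * complex_of_real (indicator A s))"
      by (intro Bochner_Integration.integral_cong) (auto simp: indicator_def)
    also have "\<dots> = z * of_real (?E p (indicator A))"
      by (simp only: integral_mult_right_zero integral_complex_of_real)
    also have "?E p (indicator A) = measure_pmf.prob p A"
      by simp
    finally show ?thesis .
  qed
  have Ec: "?E p (\<lambda>s. f (c s)) = f (- int R) +
     (\<Sum>j\<in>{1..2*R}. (f (int j - int R) - f (int j - int R - 1)) * of_real (P p (int j - int R)))" for p
    unfolding clamp P_def
    by (subst Bochner_Integration.integral_add, simp,
        intro Bochner_Integration.integrable_sum int_ind,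
        subst Bochner_Integration.integral_sum, rule int_ind, simp only: E_ind, simp)
  have bulk: "norm (?E p (\<lambda>s. f (c s)) - ?E q (\<lambda>s. f (c s))) \<le> 2 * real R * \<bar>\<theta>\<bar> * \<delta>"
  proof -
    have "?E p (\<lambda>s. f (c s)) - ?E q (\<lambda>s. f (c s)) =
       (\<Sum>j\<in>{1..2*R}. (f (int j - int R) - f (int j - int R - 1)) * of_real (P p (int j - int R) - P q (int j - int R)))"
      unfolding Ec by (simp add: sum_subtractf right_diff_distrib)
    also have "norm \<dots> \<le> (\<Sum>j\<in>{1..2*R}. \<bar>\<theta>\<bar> * \<delta>)"
      by (intro sum_norm_le, unfold norm_mult norm_of_real, intro mult_mono step)
         (use pq in \<open>auto simp: P_def\<close>)
    finally show ?thesis by (simp add: algebra_simps)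
  qed
  have intf: "integrable (measure_pmf p) (\<lambda>s. f (g s))" for p :: "int pmf" and g
    by (intro measure_pmf.integrable_const_bound[where B = 1]) (auto simp: f_def)
  have tail: "norm (?E p f - ?E p (\<lambda>s. f (c s))) \<le> 2 * T p" for p
  proof -
    have "norm (?E p f - ?E p (\<lambda>s. f (c s))) = norm (?E p (\<lambda>s. f s - f (c s)))"
      using intf[of p "\<lambda>s. s"] intf[of p c] by simp
    also have "\<dots> \<le> ?E p (\<lambda>s. norm (f s - f (c s)))"
      by (rule integral_norm_bound)
    also have "\<dots> \<le> ?E p (\<lambda>s. 2 * indicator {s. \<bar>s\<bar> > int R} s)"
    proof (rule integral_mono)
      show "integrable (measure_pmf p) (\<lambda>s. norm (f s - f (c s)))"
        using intf[of p "\<lambda>s. s"] intf[of p c] by auto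
      show "integrable (measure_pmf p) (\<lambda>s. 2 * indicator {s. \<bar>s\<bar> > int R} s :: real)"
        by (intro measure_pmf.integrable_const_bound[where B = 2]) (auto simp: indicator_def)
      fix s
      have "norm (f s - f (c s)) \<le> 2"
        using norm_triangle_ineq4[of "f s" "f (c s)"] by (simp add: f_def)
      then show "norm (f s - f (c s)) \<le> 2 * indicator {s. \<bar>s\<bar> > int R} s"
        by (auto simp: indicator_def c_def max_def min_def)
    qed
    finally show ?thesis by (simp add: T_def)
  qed
  have "T q \<le> T p + 2 * \<delta>"
  proof -
    \<comment> \<open>The tail event is a threshold event together with the complement of another
      one, so closeness at two thresholds controls it.\<close>
    have T: "T p = P p (int R + 1) + (1 - P p (- int R))" for p
    proof -
      have "T p = measure_pmf.prob p ({s. s \<ge> int R + 1} \<union> (UNIV - {s. s \<ge> - int R}))"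
        unfolding T_def by (rule arg_cong[where f = "measure_pmf.prob p"]) auto
      also have "\<dots> = P p (int R + 1) + measure_pmf.prob p (UNIV - {s. s \<ge> - int R})"
        unfolding P_def by (rule measure_pmf.finite_measure_Union) auto
      also have "measure_pmf.prob p (UNIV - {s. s \<ge> - int R}) = 1 - P p (- int R)"
        unfolding P_def using measure_pmf.prob_compl[of "{s. s \<ge> - int R}" p] by simp
      finally show ?thesis .
    qed
    have "\<bar>P p r - P q r\<bar> \<le> \<delta>" for r
      using pq by (simp add: P_def)
    from this[of "int R + 1"] this[of "- int R"] show ?thesis
      using T[of p] T[of q] by linarith
  qed
  moreover have "norm (?E p f - ?E q f) \<le> norm (?E p f - ?E p (\<lambda>s. f (c s))) +
     norm (?E p (\<lambda>s. f (c s)) - ?E q (\<lambda>s. f (c s))) + norm (?E q f - ?E q (\<lambda>s. f (c s)))"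
    using norm_add_diff_le[of "?E p f - ?E p (\<lambda>s. f (c s))" "?E p (\<lambda>s. f (c s)) - ?E q (\<lambda>s. f (c s))"
        "?E q f - ?E q (\<lambda>s. f (c s))"] by simp
  moreover note tail[of p] tail[of q] bulk
  moreover have "\<delta> * (2 * real R * \<bar>\<theta>\<bar> + 4) + 4 * T p = 2 * T p + 2 * real R * \<bar>\<theta>\<bar> * \<delta> + 2 * (T p + 2 * \<delta>)"
    by (simp add: distrib_left)
  ultimately have "norm (?E p f - ?E q f) \<le> \<delta> * (2 * real R * \<bar>\<theta>\<bar> + 4) + 4 * T p"
    by argo
  moreover have "char_sum r \<theta> = ?E r f" for r
    by (simp only: char_sum_def f_def[abs_def])
  ultimately show ?thesis
    by (simp only: T_def)
qed

text \<open>Each factor $2 - 2\cos(h(s - j))$ splits into three exponentials of total weight 4.\<close>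

lemma norm_expectation_diff_prod_le:
  fixes p q :: "int pmf" and J :: "int set"
  assumes fin: "finite (set_pmf p)" "finite (set_pmf q)" "finite J"
    and K: "\<And>\<phi>. \<bar>\<phi>\<bar> \<le> M \<Longrightarrow> norm (char_sum p \<phi> - char_sum q \<phi>) \<le> K"
    and "h \<ge> 0" "\<bar>\<psi>\<bar> + real (card J) * h \<le> M"
  defines "F \<equiv> (\<lambda>\<psi> J s. cis (\<psi> * of_int s) * of_real (\<Prod>j\<in>J. 2 - 2 * cos (h * of_int (s - j))))"
  shows "norm (measure_pmf.expectation p (F \<psi> J) - measure_pmf.expectation q (F \<psi> J)) \<le> 4 ^ card J * K"
  using fin(3) assms(6)
\<comment> \<open>Splitting off one factor moves the frequency to \<psi> + h and \<psi> - h. Hence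
  \<psi> is kept arbitrary, and \<open>M\<close> reserves one \<open>h\<close> for each remaining
  factor.\<close>
proof (induction J arbitrary: \<psi> rule: finite_induct)
  case empty
  then show ?case using K[of \<psi>] by (simp add: F_def char_sum_def)
next
  case (insert j J)
  let ?E = "\<lambda>p f. measure_pmf.expectation p f"
  have split: "F \<psi> (insert j J) s = 2 * F \<psi> J s - cis (- h * of_int j) * F (\<psi> + h) J s
      - cis (h * of_int j) * F (\<psi> - h) J s" for s
  proof -
    have c: "complex_of_real (2 * cos x) = cis x + cis (- x)" for x
      by (simp add: complex_eq_iff)
    have "F \<psi> (insert j J) s = cis (\<psi> * of_int s) * (2 - complex_of_real (2 * cos (h * of_int (s - j))))
        * of_real (\<Prod>j\<in>J. 2 - 2 * cos (h * of_int (s - j)))"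
      using insert by (simp add: F_def)
    also have "cis (\<psi> * of_int s) * (2 - complex_of_real (2 * cos (h * of_int (s - j)))) =
       2 * cis (\<psi> * of_int s) - cis (- h * of_int j) * cis ((\<psi> + h) * of_int s) - cis (h * of_int j) * cis ((\<psi> - h) * of_int s)"
      unfolding c by (simp add: right_diff_distrib distrib_left cis_mult) (simp add: algebra_simps)
    finally show ?thesis by (simp add: F_def algebra_simps)
  qed
  have E: "?E r (F \<psi> (insert j J)) = 2 * ?E r (F \<psi> J) - cis (- h * of_int j) * ?E r (F (\<psi> + h) J)
      - cis (h * of_int j) * ?E r (F (\<psi> - h) J)" if "finite (set_pmf r)" for r
  proof -
    have I: "integrable (measure_pmf r) f" for f :: "int \<Rightarrow> complex"
      by (rule integrable_measure_pmf_finite[OF that])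
    show ?thesis
      unfolding split by (simp add: I)
  qed
  let ?d = "\<lambda>\<psi>. ?E p (F \<psi> J) - ?E q (F \<psi> J)"
  have eq: "?E p (F \<psi> (insert j J)) - ?E q (F \<psi> (insert j J)) =
     2 * ?d \<psi> - cis (- h * of_int j) * ?d (\<psi> + h) - cis (h * of_int j) * ?d (\<psi> - h)"
    unfolding E[OF fin(1)] E[OF fin(2)] by (simp add: algebra_simps)
  have "norm (?E p (F \<psi> (insert j J)) - ?E q (F \<psi> (insert j J))) \<le> norm (2 * ?d \<psi>) + norm (cis (- h * of_int j) * ?d (\<psi> + h))
       + norm (cis (h * of_int j) * ?d (\<psi> - h))"
    unfolding eq
    using norm_add_diff_le[of "2 * ?d \<psi>" "- (cis (- h * of_int j) * ?d (\<psi> + h))"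
        "cis (h * of_int j) * ?d (\<psi> - h)"] by simp
  also have "\<dots> = 2 * norm (?d \<psi>) + norm (?d (\<psi> + h)) + norm (?d (\<psi> - h))"
    by (simp only: norm_mult norm_cis norm_numeral mult_1)
  also have "\<dots> \<le> 4 ^ card (insert j J) * K"
  proof -
    have prem: "\<bar>\<psi>\<bar> + real (card J) * h + h \<le> M"
      using insert.prems insert.hyps by (simp add: distrib_right add_ac)
    have "norm (?d \<psi>) \<le> 4 ^ card J * K" "norm (?d (\<psi> + h)) \<le> 4 ^ card J * K"
        "norm (?d (\<psi> - h)) \<le> 4 ^ card J * K"
      using prem \<open>h \<ge> 0\<close> by (intro insert.IH; linarith)+
    then show ?thesis using insert.hyps by simp
  qed
  finally show ?case .
qed

section \<open>Monic polynomials at separated points\<close>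

text \<open>The sum is the k-th divided difference of \<open>p\<close>. Lagrange interpolation
  \<open>L\<close> at k + 1 nodes reproduces \<open>p\<close>, since \<open>p - L\<close> has degree
  at most k and k + 1 roots; comparing the coefficients of x^k gives 1.\<close>

lemma sum_divided_difference_monic:
  fixes u :: "nat \<Rightarrow> 'a :: field" and p :: "'a poly"
  assumes inj: "inj_on u {..k}" and p: "degree p = k" "lead_coeff p = 1"
  shows "(\<Sum>i\<le>k. poly p (u i) / (\<Prod>l\<in>{..k} - {i}. u i - u l)) = 1"
proof -
  define N where "N i = (\<Prod>l\<in>{..k} - {i}. [:- u l, 1:])" for i
  define D where "D i = (\<Prod>l\<in>{..k} - {i}. u i - u l)" for i
  define L where "L = (\<Sum>i\<le>k. smult (poly p (u i) / D i) (N i))"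
  have D0: "D i \<noteq> 0" if "i \<le> k" for i
    using inj that by (auto simp: D_def inj_on_def)
  have degN: "degree (N i) = k" if "i \<le> k" for i
    using that by (simp add: N_def degree_prod_sum_eq)
  have lcN: "coeff (N i) k = 1" if "i \<le> k" for i
    using degN[OF that] lead_coeff_prod[of "\<lambda>l. [:- u l, 1:]" "{..k} - {i}"] by (simp add: N_def)
  have polyN: "poly (N i) (u j) = (if i = j then D i else 0)" if "i \<le> k" "j \<le> k" for i j
    using that by (auto simp: N_def D_def poly_prod intro!: prod.cong)
  have "poly L (u j) = poly p (u j)" if "j \<le> k" for j
  proof -
    have "poly L (u j) = (\<Sum>i\<le>k. if i = j then poly p (u j) else 0)"
      unfolding L_def poly_sum using that D0 polyN by (intro sum.cong) auto
    then show ?thesis using that by simp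
  qed
  then have roots: "u ` {..k} \<subseteq> {x. poly (p - L) x = 0}" by auto
  have "degree L \<le> k"
    unfolding L_def by (intro degree_sum_le) (auto simp: degN)
  then have deg: "degree (p - L) \<le> k"
    using p by (intro degree_diff_le) auto
  have "p - L = 0"
  proof (rule ccontr)
    assume nz: "p - L \<noteq> 0"
    have "Suc k = card (u ` {..k})" using inj by (simp add: card_image)
    also have "\<dots> \<le> card {x. poly (p - L) x = 0}"
      using roots nz by (intro card_mono poly_roots_finite) auto
    also have "\<dots> \<le> degree (p - L)" using nz by (rule card_poly_roots_bound)
    finally show False using deg by simp
  qed
  then have "coeff L k = 1" using p by auto
  then show ?thesis
    by (simp add: L_def coeff_sum lcN D_def)
qed

text \<open>The separation bounds the i-th denominator of the divided difference below by c^k i! (k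
  - i)!. If every value were smaller than claimed, the divided difference would be less than 2^(-k)
  times the sum of all C(k, i), which is 1.\<close>

lemma ex_monic_large:
  fixes u :: "nat \<Rightarrow> 'a :: real_normed_field" and p :: "'a poly"
  assumes p: "degree p = k" "lead_coeff p = 1" and c: "c > 0"
    and sep: "\<And>i l. i \<le> k \<Longrightarrow> l \<le> k \<Longrightarrow> c * \<bar>real i - real l\<bar> \<le> norm (u i - u l)"
  shows "\<exists>i\<le>k. fact k * (c / 2) ^ k \<le> norm (poly p (u i))"
proof (rule ccontr)
  assume "\<not> ?thesis"
  then have small: "norm (poly p (u i)) < fact k * (c / 2) ^ k" if "i \<le> k" for i
    using that by auto
  have inj: "inj_on u {..k}"
  proof (rule inj_onI)
    fix i l assume *: "i \<in> {..k}" "l \<in> {..k}" "u i = u l"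
    then have "c * \<bar>real i - real l\<bar> \<le> 0" using sep[of i l] by simp
    then show "i = l" using c by (simp add: mult_le_0_iff)
  qed
  have den: "c ^ k * (fact i * fact (k - i)) \<le> norm (\<Prod>l\<in>{..k} - {i}. u i - u l)" if "i \<le> k" for i
  proof -
    have split: "{..k} - {i} = {..<i} \<union> {Suc i..k}" using that by auto
    have low: "(\<Prod>l\<in>{..<i}. \<bar>real i - real l\<bar>) = fact i"
    proof -
      have "(\<Prod>l\<in>{..<i}. \<bar>real i - real l\<bar>) = (\<Prod>l\<in>{1..i}. real l)"
        by (rule prod.reindex_bij_witness[of _ "\<lambda>l. i - l" "\<lambda>l. i - l"]) (auto simp: of_nat_diff)
      then show ?thesis by (simp add: fact_prod)
    qed
    have high: "(\<Prod>l\<in>{Suc i..k}. \<bar>real i - real l\<bar>) = fact (k - i)"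
    proof -
      have "(\<Prod>l\<in>{Suc i..k}. \<bar>real i - real l\<bar>) = (\<Prod>l\<in>{1..k - i}. real l)"
        by (rule prod.reindex_bij_witness[of _ "\<lambda>l. l + i" "\<lambda>l. l - i"]) auto
      then show ?thesis by (simp add: fact_prod)
    qed
    have "(\<Prod>l\<in>{..k} - {i}. c * \<bar>real i - real l\<bar>) \<le> (\<Prod>l\<in>{..k} - {i}. norm (u i - u l))"
      using that c sep by (intro prod_mono) auto
    moreover have "(\<Prod>l\<in>{..k} - {i}. c * \<bar>real i - real l\<bar>) = c ^ k * (\<Prod>l\<in>{..k} - {i}. \<bar>real i - real l\<bar>)"
      using that by (simp add: prod.distrib)
    moreover have "(\<Prod>l\<in>{..k} - {i}. \<bar>real i - real l\<bar>) = fact i * fact (k - i)"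
      unfolding split low [symmetric] high [symmetric] by (rule prod.union_disjoint) auto
    ultimately show ?thesis by (simp add: prod_norm)
  qed
  have "1 = norm (\<Sum>i\<le>k. poly p (u i) / (\<Prod>l\<in>{..k} - {i}. u i - u l))"
    using sum_divided_difference_monic[OF inj p] by simp
  also have "\<dots> \<le> (\<Sum>i\<le>k. norm (poly p (u i)) / norm (\<Prod>l\<in>{..k} - {i}. u i - u l))"
    by (rule order_trans[OF norm_sum]) (simp add: norm_divide)
  also have "\<dots> < (\<Sum>i\<le>k. (fact k * (c / 2) ^ k) / (c ^ k * (fact i * fact (k - i))))"
  proof (rule sum_strict_mono)
    fix i assume "i \<in> {..k}"
    then have i: "i \<le> k" by simp
    have pos: "0 < c ^ k * (fact i * fact (k - i) :: real)" using c by simp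
    show "norm (poly p (u i)) / norm (\<Prod>l\<in>{..k} - {i}. u i - u l)
          < (fact k * (c / 2) ^ k) / (c ^ k * (fact i * fact (k - i)))"
      using small[OF i] den[OF i] pos by (intro frac_less) auto
  qed auto
  also have "\<dots> = (\<Sum>i\<le>k. (1 / 2) ^ k * real (k choose i))"
    using c by (intro sum.cong) (auto simp: binomial_fact power_divide)
  also have "\<dots> = 1"
  proof -
    have "(\<Sum>i\<le>k. real (k choose i)) = 2 ^ k"
      by (metis choose_row_sum of_nat_numeral of_nat_power of_nat_sum)
    then show ?thesis by (simp add: sum_divide_distrib [symmetric] power_divide)
  qed
  finally show False by simp
qed

section \<open>The test function under the binomial distribution\<close>

text \<open>The law of a sum of n independent fair signs, encoded through the number
  \<open>w\<close> of positive signs so that expectations become binomial sums.\<close>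

definition rademacher_sum :: "nat \<Rightarrow> int pmf" where
  "rademacher_sum n = map_pmf (\<lambda>w. 2 * int w - int n) (binomial_pmf n (1 / 2))"

lemma expectation_rademacher_sum:
  fixes f :: "int \<Rightarrow> 'a :: {banach, second_countable_topology}"
  shows "measure_pmf.expectation (rademacher_sum n) f =
    (\<Sum>w\<le>n. (real (n choose w) / 2 ^ n) *\<^sub>R f (2 * int w - int n))"
proof -
  have "(1 / 2) ^ w * (1 - 1 / 2) ^ (n - w) = 1 / (2::real) ^ n" if "w \<le> n" for w
    using that by (simp add: power_divide power_add [symmetric])
  then show ?thesis
    unfolding rademacher_sum_def
    by (auto simp: expectation_binomial_pmf' mult.assoc intro!: sum.cong)
qed

lemma cos_ge_half: "1 / 2 \<le> cos x" if "\<bar>x\<bar> \<le> 1" for x :: real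
proof -
  have "\<bar>x / 2\<bar>\<^sup>2 \<le> (1 / 2)\<^sup>2" using that by (intro power_mono) auto
  moreover have "\<bar>sin (x / 2)\<bar>\<^sup>2 \<le> \<bar>x / 2\<bar>\<^sup>2"
    using abs_sin_x_le_abs_x[of "x / 2"] by (intro power_mono) auto
  moreover have "cos x = 1 - 2 * (sin (x / 2))\<^sup>2"
    using cos_double_sin[of "x / 2"] by simp
  ultimately show ?thesis by (simp add: power2_eq_square)
qed

lemma abs_le_two_sin: "\<bar>x\<bar> \<le> 2 * \<bar>sin x\<bar>" if "\<bar>x\<bar> \<le> 1" for x :: real
proof -
  have pos: "y \<le> 2 * sin y" if y: "0 < y" "y \<le> 1" for y :: real
  proof -
    obtain z where z: "0 < z" "z < y" "sin y - sin 0 = (y - 0) * cos z"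
      using MVT2[of 0 y sin cos] y by (metis DERIV_sin)
    have "y * (1 / 2) \<le> y * cos z"
      using cos_ge_half[of z] z y by (intro mult_left_mono) auto
    then show ?thesis using z by simp
  qed
  show ?thesis
    using pos[of "\<bar>x\<bar>"] that by (cases "x = 0"; cases "x > 0") (auto simp: abs_if split: if_splits)
qed

text \<open>The $k + 1$ nodes are taken from disjoint cells of \<open>a\<close> consecutive lattice points; each cell
  carries binomial mass at least $e^{-O(k)}$.\<close>

lemma expectation_prod_cos_ge:
  fixes J :: "int set" and n k :: nat and \<rho> :: real
  assumes J: "finite J" "card J = k" and k: "0 < k" "k \<le> n" and \<rho>: "0 < \<rho>" "\<rho> \<le> 1"
  defines "h \<equiv> sqrt (\<rho> / (real n * real k)) / 2"
  shows "exp (- 100 * real k / \<rho>) \<le>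
    measure_pmf.expectation (rademacher_sum n) (\<lambda>s. \<Prod>j\<in>J. 2 - 2 * cos (h * of_int (s - j)))"
proof -
  define H where "H s = (\<Prod>j\<in>J. 2 - 2 * cos (h * of_int (s - j)))" for s :: int
  \<comment> \<open>\<open>b\<close> is the distance between the starts of consecutive cells.
    Rounding down gives b^2 k \<le> n, and b \<ge> 1 makes the loss at most a factor 2.\<close>
  define b where "b = nat \<lfloor>sqrt (real n / real k)\<rfloor>"
  \<comment> \<open>A cell fills only half of its period, rounded up, so offsets within cells differ
    by at most \<open>a - 1\<close>, hence by at most b/2.\<close>
  define a where "a = (b + 1) div 2"
  \<comment> \<open>The cells 0 to k together span \<open>w0\<close> to \<open>w0 + N\<close>;
    \<open>w0\<close> centres this block at n/2 up to rounding.\<close>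
  define N where "N = k * b + a - 1"
  define w0 where "w0 = (n - N) div 2"
  define cell where "cell i = {w0 + i * b..<w0 + i * b + a}" for i
  define p where "p = (\<Prod>j\<in>J. [:- cis (h * of_int j), 1:])"
  define y where "y w = 2 * int w - int n" for w :: nat
  have n: "0 < n" using k by simp
  have h: "0 < h" using n k \<rho> by (simp add: h_def)

  have b1: "1 \<le> b"
    using k n by (simp add: b_def le_nat_iff le_floor_iff)
  have "real b \<le> sqrt (real n / real k)"
    using k by (simp add: b_def)
  then have b2: "(real b)\<^sup>2 * real k \<le> real n"
    using k power_mono[of "real b" "sqrt (real n / real k)" 2] by (simp add: field_simps)
  have b3: "sqrt (real n / real k) \<le> 2 * real b"
    using b1 unfolding b_def by linarith
  have a: "1 \<le> a" "b \<le> 2 * a" "2 * (a - 1) \<le> b" "a \<le> b"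
    using b1 by (auto simp: a_def)
  have bbk: "b * b * k \<le> n"
    using b2 by (simp add: power2_eq_square flip: of_nat_mult)
  have N2: "N \<le> 2 * (k * b)"
  proof -
    have "b \<le> k * b" using k by simp
    then show ?thesis using a unfolding N_def by linarith
  qed
  \<comment> \<open>For \<open>b \<ge> 2\<close>, N \<le> 2kb \<le> b^2 k \<le> n. For
    \<open>b = 1\<close> the cells are single points and N = k.\<close>
  have Nn: "N \<le> n"
  proof (cases "b = 1")
    case True
    then show ?thesis using k a by (simp add: N_def)
  next
    case False
    then have "2 * (k * b) \<le> b * (k * b)" using b1 by (intro mult_right_mono) auto
    moreover have "b * (k * b) = b * b * k" by simp
    ultimately show ?thesis using bbk N2 by linarith
  qed
  have cell: "w0 \<le> w" "w \<le> w0 + N" if "w \<in> cell i" "i \<le> k" for w i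
  proof -
    have "i * b \<le> k * b" "w0 + i * b \<le> w \<and> w < w0 + i * b + a" using that by (simp_all add: cell_def)
    then show "w0 \<le> w" "w \<le> w0 + N" using a(1) unfolding N_def by linarith+
  qed
  have celln: "w \<le> n" if "w \<in> cell i" "i \<le> k" for w i
    using cell[OF that] Nn by (simp add: w0_def)

  \<comment> \<open>All points of the block satisfy |2w - n| \<le> N + 1, where the 1 comes from
    rounding \<open>w0\<close>. Since N + 2 \<le> 4kb and (kb)^2 \<le> kn, the Gaussian exponent is
    at most 64k.\<close>
  have mass: "exp (- 64 * real k) / (3 * sqrt n) \<le> real (n choose w) / 2 ^ n" if w: "w \<in> cell i" "i \<le> k" for w i
  proof -
    have "int w \<ge> int w0" "int w \<le> int w0 + int N" "2 * int w0 \<le> int n - int N" "2 * int w0 \<ge> int n - int N - 1"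
      using cell[OF w] Nn unfolding w0_def by linarith+
    then have "\<bar>2 * int w - int n\<bar> \<le> int N + 1" by linarith
    then have "real_of_int \<bar>2 * int w - int n\<bar> \<le> real_of_int (int N + 1)" by (simp only: of_int_le_iff)
    then have D: "\<bar>2 * real w - real n\<bar> \<le> real N + 1" by simp
    have "real N + 1 + 1 \<le> 4 * (real k * real b)"
    proof -
      have "N + 2 \<le> 4 * (k * b)" using N2 k b1 by (cases "k * b") auto
      then show ?thesis by (simp flip: of_nat_mult of_nat_add)
    qed
    then have "4 * (real N + 1 + 1)\<^sup>2 \<le> 4 * (4 * (real k * real b))\<^sup>2"
      by (intro mult_left_mono power_mono) auto
    also have "\<dots> = 64 * real k * ((real b)\<^sup>2 * real k)" by (simp add: power2_eq_square)
    also have "\<dots> \<le> 64 * real k * real n" using b2 by (intro mult_left_mono) auto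
    finally have "4 * (real N + 1 + 1)\<^sup>2 / n \<le> 64 * real k" using n by (simp add: field_simps)
    then have "2 ^ n * exp (- 64 * real k) \<le> 2 ^ n * exp (- (4 * (real N + 1 + 1)\<^sup>2 / n))" by simp
    also have "\<dots> \<le> 3 * sqrt n * real (n choose w)"
      by (rule binomial_ge_gaussian[OF n celln[OF w] D])
    finally show ?thesis using n by (simp add: field_simps)
  qed

  \<comment> \<open>A squared chord of the unit circle is 2 - 2 cos of the angle, so
    \<open>H\<close> is the squared modulus of the monic polynomial \<open>p\<close> on the
    circle.\<close>
  have H: "H s = (norm (poly p (cis (h * of_int s))))\<^sup>2" for s
  proof -
    have "2 - 2 * cos (h * of_int (s - j)) = (norm (cis (h * of_int s) - cis (h * of_int j)))\<^sup>2" for j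
    proof -
      have "h * of_int (s - j) = 2 * ((h * of_int s - h * of_int j) / 2)" by (simp add: algebra_simps)
      then have "cos (h * of_int (s - j)) = 1 - 2 * (sin ((h * of_int s - h * of_int j) / 2))\<^sup>2"
        by (metis cos_double_sin)
      then show ?thesis by (simp add: norm_cis_diff power_mult_distrib)
    qed
    then show ?thesis
      by (simp add: H_def p_def poly_prod prod_norm [symmetric] prod_power_distrib)
  qed
  have H0: "0 \<le> H s" for s by (simp add: H)

  \<comment> \<open>The node of each cell is a minimiser of \<open>H\<close> there, so largeness at
    one node spreads to its whole cell.\<close>
  have "\<exists>w. w \<in> cell i \<and> (\<forall>w'\<in>cell i. H (y w) \<le> H (y w'))" for i
    using a arg_min_if_finite[of "cell i" "\<lambda>w. H (y w)"] by (auto simp: cell_def not_less)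
  then obtain v where v: "\<And>i. v i \<in> cell i" "\<And>i w. w \<in> cell i \<Longrightarrow> H (y (v i)) \<le> H (y w)"
    by metis
  \<comment> \<open>This is the separation of the nodes on the circle: h b / 2 is at least sqrt
    \<rho> / (8k), because b \<ge> sqrt(n/k) / 2.\<close>
  define c where "c = sqrt \<rho> / (8 * real k)"
  have "\<exists>i\<le>k. fact k * (c / 2) ^ k \<le> norm (poly p (cis (h * of_int (y (v i)))))"
  proof (rule ex_monic_large)
    show "degree p = k" using J by (simp add: p_def degree_prod_sum_eq)
    show "lead_coeff p = 1" by (simp add: p_def lead_coeff_prod)
    show "0 < c" using \<rho> k by (simp add: c_def)
    fix i l assume il: "i \<le> k" "l \<le> k"
    define d where "d = real (v i) - real (v l)"
    \<comment> \<open>For distinct cells the offsets take away at most b/2, which is at most half of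
      b|i - l|.\<close>
    have "real b * \<bar>real i - real l\<bar> / 2 \<le> \<bar>d\<bar>"
    proof (cases "i = l")
      case False
      obtain r s where r: "v i = w0 + i * b + r" "r < a" and s: "v l = w0 + l * b + s" "s < a"
        using v(1)[of i] v(1)[of l] unfolding cell_def
        by (metis atLeastLessThan_iff le_iff_add nat_add_left_cancel_less)
      have d: "d = real b * (real i - real l) + (real r - real s)"
        by (simp add: d_def r s algebra_simps)
      have "2 * r \<le> b" "2 * s \<le> b" using r s a(3) by linarith+
      then have "real (2 * r) \<le> real b" "real (2 * s) \<le> real b" by (simp_all only: of_nat_le_iff)
      then have "\<bar>real r - real s\<bar> \<le> real b / 2" by linarith
      moreover have "real b * 1 \<le> real b * \<bar>real i - real l\<bar>" using False by (intro mult_left_mono) auto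
      moreover have "\<bar>real b * (real i - real l)\<bar> = real b * \<bar>real i - real l\<bar>" by (simp add: abs_mult)
      moreover have "\<bar>real b * (real i - real l)\<bar> \<le> \<bar>d\<bar> + \<bar>real r - real s\<bar>"
        unfolding d by linarith
      ultimately show ?thesis by linarith
    qed simp
    then have s1: "h * (real b * \<bar>real i - real l\<bar> / 2) \<le> h * \<bar>d\<bar>" using h by (intro mult_left_mono) auto
    have s2: "c * \<bar>real i - real l\<bar> \<le> (h * real b / 2) * \<bar>real i - real l\<bar>"
    proof (intro mult_right_mono)
      have "sqrt \<rho> / real k = sqrt (real n / real k) * sqrt (\<rho> / (real n * real k))"
        using n k by (simp add: real_sqrt_divide real_sqrt_mult field_simps)
      also have "\<dots> \<le> (2 * real b) * (2 * h)" using b3 \<rho> by (intro mult_mono) (auto simp: h_def)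
      finally have "sqrt \<rho> / real k \<le> 2 * real b * (2 * h)" .
      moreover have "c = sqrt \<rho> / real k / 8" by (simp add: c_def)
      ultimately show "c \<le> h * real b / 2" by (simp add: mult.commute)
    qed simp
    \<comment> \<open>The nodes differ by the angle 2hd, with chord 2|sin(hd)|. The block is short
      enough for hd to stay where the sine is linear up to a factor 2.\<close>
    have s3: "\<bar>h * d\<bar> \<le> 1"
    proof -
      have "\<bar>d\<bar> \<le> real N"
        using cell[OF v(1) il(1)] cell[OF v(1) il(2)] unfolding d_def by linarith
      also have "\<dots> \<le> 2 * (real k * real b)" using N2 by (simp flip: of_nat_mult)
      finally have "\<bar>h * d\<bar> \<le> h * (2 * (real k * real b))"
        using h by (simp add: abs_mult)
      also have "\<dots> = sqrt (\<rho> * (((real b)\<^sup>2 * real k) / real n))"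
        using n k by (simp add: h_def real_sqrt_divide real_sqrt_mult field_simps)
      also have "\<dots> \<le> sqrt (1 * 1)"
        using \<rho> b2 n by (intro real_sqrt_le_mono mult_mono) auto
      finally show ?thesis by simp
    qed
    have s4: "norm (cis (h * of_int (y (v i))) - cis (h * of_int (y (v l)))) = 2 * \<bar>sin (h * d)\<bar>"
    proof -
      have "(h * of_int (y (v i)) - h * of_int (y (v l))) / 2 = h * d"
        by (simp add: y_def d_def diff_divide_distrib algebra_simps)
      then show ?thesis by (simp only: norm_cis_diff)
    qed
    note s2
    also have "(h * real b / 2) * \<bar>real i - real l\<bar> = h * (real b * \<bar>real i - real l\<bar> / 2)" by simp
    also note s1
    also have "h * \<bar>d\<bar> = \<bar>h * d\<bar>" using h by (simp add: abs_mult)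
    also note abs_le_two_sin[OF s3]
    also note s4 [symmetric]
    finally show "c * \<bar>real i - real l\<bar> \<le> norm (cis (h * of_int (y (v i))) - cis (h * of_int (y (v l))))" .
  qed
  then obtain i where i: "i \<le> k" "fact k * (c / 2) ^ k \<le> norm (poly p (cis (h * of_int (y (v i)))))"
    by blast
  have c0: "0 \<le> c" using \<rho> by (simp add: c_def)
  have Hi: "(fact k * (c / 2) ^ k)\<^sup>2 \<le> H (y (v i))"
    unfolding H using i c0 by (intro power_mono) auto
  have "real a * (exp (- 64 * real k) / (3 * sqrt n) * (fact k * (c / 2) ^ k)\<^sup>2)
       = (\<Sum>w\<in>cell i. exp (- 64 * real k) / (3 * sqrt n) * (fact k * (c / 2) ^ k)\<^sup>2)"
    by (simp add: cell_def)
  also have "\<dots> \<le> (\<Sum>w\<in>cell i. real (n choose w) / 2 ^ n * H (y w))"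
    using mass[OF _ i(1)] Hi v(2)[of _ i] by (intro sum_mono mult_mono) (auto intro: order_trans)
  also have "\<dots> \<le> (\<Sum>w\<le>n. real (n choose w) / 2 ^ n * H (y w))"
    using celln[OF _ i(1)] H0 by (intro sum_mono2) auto
  also have "\<dots> = measure_pmf.expectation (rademacher_sum n) H"
    by (simp add: expectation_rademacher_sum y_def)
  finally have E: "real a * (exp (- 64 * real k) / (3 * sqrt n) * (fact k * (c / 2) ^ k)\<^sup>2)
      \<le> measure_pmf.expectation (rademacher_sum n) H" .

  have ek: "real k \<le> exp (real k)" using exp_ge_add_one_self[of "real k"] by linarith
  have e2: "2 \<le> exp (1::real)" using exp_ge_add_one_self[of 1] by simp
  \<comment> \<open>A cell has about sqrt(n/k) points, each weighted by 1 / (3 sqrt n), so n cancels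
    and at least 1 / (12 sqrt k) remains.\<close>
  have A: "exp (- 5 * real k) \<le> real a / (3 * sqrt n)"
  proof -
    have "12 * sqrt k \<le> 16 * real k"
      using k real_sqrt_le_mono[of "real k" "(real k)\<^sup>2"] by (simp add: power2_eq_square)
    also have "\<dots> \<le> exp (4 * real k) * exp (real k)"
    proof (intro mult_mono ek)
      have "16 = (2::real) ^ 4" by simp
      also have "\<dots> \<le> exp 1 ^ 4" using e2 by (intro power_mono) auto
      also have "\<dots> = exp 4" by (simp add: exp_of_nat_mult [symmetric])
      also have "\<dots> \<le> exp (4 * real k)" using k by simp
      finally show "16 \<le> exp (4 * real k)" .
    qed auto
    also have "\<dots> = exp (5 * real k)" by (simp add: exp_add [symmetric])
    finally have "exp (- 5 * real k) \<le> 1 / (12 * sqrt k)"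
      using k by (simp add: exp_minus field_simps)
    also have "\<dots> = sqrt (real n / real k) / 4 / (3 * sqrt n)"
      using n by (simp add: real_sqrt_divide)
    also have "\<dots> \<le> real a / (3 * sqrt n)"
      using b3 a(2) by (intro divide_right_mono) auto
    finally show ?thesis .
  qed
  \<comment> \<open>The right side is (k!/k^k)^2 (\<rho>/256)^k. The three factors are bounded using
    k! \<ge> (k/e)^k, 256 \<le> e^8 and \<rho> \<ge> exp(-1/\<rho>).\<close>
  have F: "exp (- 10 * real k) * exp (- real k / \<rho>) \<le> (fact k * (c / 2) ^ k)\<^sup>2"
  proof -
    have "real k ^ k / fact k \<le> exp (real k)"
    proof -
      have s: "(\<lambda>j. real k ^ j / fact j) sums exp (real k)"
        using exp_converges[of "real k"] by (simp add: field_simps)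
      from sum_le_suminf[OF sums_summable[OF s], of "{k}"] show ?thesis
        by (simp add: sums_unique[OF s, symmetric])
    qed
    then have f1: "exp (- real k) \<le> fact k / real k ^ k"
      using k by (simp add: exp_minus field_simps)
    have f2: "exp (- 8) \<le> (1 / 256 :: real)"
    proof -
      have "(2::real) ^ 8 \<le> exp 1 ^ 8" using e2 by (intro power_mono) auto
      also have "\<dots> = exp 8" by (simp add: exp_of_nat_mult [symmetric])
      finally show ?thesis by (simp add: exp_minus field_simps)
    qed
    have "ln (1 / \<rho>) \<le> 1 / \<rho> - 1" using \<rho> by (intro ln_le_minus_one) auto
    then have f3: "exp (- (1 / \<rho>)) \<le> \<rho>"
      using \<rho> by (simp add: ln_div flip: ln_ge_iff)
    have "exp (- 10 * real k) * exp (- real k / \<rho>) = (exp (- real k))\<^sup>2 * (exp (- 8) * exp (- (1 / \<rho>))) ^ k"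
      by (simp add: exp_of_nat_mult [symmetric] exp_add [symmetric] exp_double [symmetric] field_simps)
    also have "\<dots> \<le> (fact k / real k ^ k)\<^sup>2 * (1 / 256 * \<rho>) ^ k"
      using f1 f2 f3 \<rho> by (intro mult_mono power_mono) auto
    also have "1 / 256 * \<rho> = (sqrt \<rho> / 16)\<^sup>2" using \<rho> by (simp add: power_divide)
    also have "((sqrt \<rho> / 16)\<^sup>2) ^ k = ((sqrt \<rho> / 16) ^ k)\<^sup>2"
      by (simp only: power_mult [symmetric] mult.commute)
    also have "(fact k / real k ^ k)\<^sup>2 * ((sqrt \<rho> / 16) ^ k)\<^sup>2 = (fact k * (c / 2) ^ k)\<^sup>2"
      unfolding power_mult_distrib [symmetric] c_def
      by (simp add: power_divide power_mult_distrib)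
    finally show ?thesis .
  qed
  \<comment> \<open>The losses are 5k + 64k + 10k from \<open>A\<close>, \<open>mass\<close> and
    \<open>F\<close>, plus k/\<rho>; since \<rho> \<le> 1 they total at most 80k/\<rho>.\<close>
  have "exp (- 100 * real k / \<rho>) \<le> exp (- 79 * real k - real k / \<rho>)"
  proof -
    have "real k * 1 \<le> real k * (1 / \<rho>)" using \<rho> by (intro mult_left_mono) auto
    then show ?thesis by simp
  qed
  also have "\<dots> = exp (- 5 * real k) * exp (- 64 * real k) * (exp (- 10 * real k) * exp (- real k / \<rho>))"
    by (simp add: exp_add [symmetric])
  also have "\<dots> \<le> (real a / (3 * sqrt n)) * exp (- 64 * real k) * (fact k * (c / 2) ^ k)\<^sup>2"
    using A F by (intro mult_mono) auto
  also have "\<dots> \<le> measure_pmf.expectation (rademacher_sum n) H"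
    using E by (simp add: field_simps)
  finally show ?thesis by (simp add: H_def [abs_def])
qed

section \<open>Noise on the cube\<close>

text \<open>Independence, one coordinate at a time. Finite supports turn the expectations into
  finite sums.\<close>

lemma expectation_prod_Pi_pmf_finite:
  fixes f :: "'a \<Rightarrow> 'b \<Rightarrow> 'c :: {real_normed_field, banach, second_countable_topology}"
  assumes A: "finite A" and fin: "\<And>x. x \<in> A \<Longrightarrow> finite (set_pmf (p x))"
  shows "measure_pmf.expectation (Pi_pmf A d p) (\<lambda>y. \<Prod>x\<in>A. f x (y x)) =
    (\<Prod>x\<in>A. measure_pmf.expectation (p x) (f x))"
  using A fin
proof (induction A rule: finite_induct)
  case empty
  then show ?case by simp
next
  case (insert x A)
  let ?P = "Pi_pmf A d p"
  have finP: "finite (set_pmf ?P)"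
    using insert by (subst set_Pi_pmf) (auto intro!: finite_PiE_dflt)
  have "measure_pmf.expectation (Pi_pmf (insert x A) d p) (\<lambda>y. \<Prod>x\<in>insert x A. f x (y x)) =
     measure_pmf.expectation (p x \<bind> (\<lambda>b. map_pmf (\<lambda>g. g(x := b)) ?P)) (\<lambda>y. \<Prod>x\<in>insert x A. f x (y x))"
    using insert.hyps by (simp add: Pi_pmf_insert' map_pmf_def)
  also have "\<dots> = (\<Sum>b\<in>set_pmf (p x). pmf (p x) b *\<^sub>R
      measure_pmf.expectation ?P (\<lambda>g. f x b * (\<Prod>z\<in>A. f z (g z))))"
  proof (subst pmf_expectation_bind[of "set_pmf (p x)"], goal_cases)
    case 4
    have "(\<Prod>z\<in>A. f z ((g(x := b)) z)) = (\<Prod>z\<in>A. f z (g z))" for g b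
      using insert.hyps by (intro prod.cong) auto
    then show ?case using insert.hyps by simp
  qed (use insert finP in auto)
  also have "\<dots> = (\<Sum>b\<in>set_pmf (p x). pmf (p x) b *\<^sub>R f x b) * (\<Prod>z\<in>A. measure_pmf.expectation (p z) (f z))"
    using insert by (simp add: sum_distrib_right)
  also have "(\<Sum>b\<in>set_pmf (p x). pmf (p x) b *\<^sub>R f x b) = measure_pmf.expectation (p x) (f x)"
    using insert by (subst integral_measure_pmf[of "set_pmf (p x)"]) auto
  finally show ?case using insert.hyps by simp
qed

text \<open>A point of the cube corresponds to the set of its positive coordinates. A uniform subset
  has independent fair membership bits, so its size is binomial.\<close>

lemma map_coord_sum_uniform_cube: "map_pmf (coord_sum n) (uniform_cube n) = rademacher_sum n"
proof -
  let ?\<sigma> = "\<lambda>A. \<lambda>i\<in>{..<n}. if i \<in> A then 1 else - 1 :: int"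
  have bij: "bij_betw ?\<sigma> (Pow {..<n}) (cube n)"
    by (rule bij_betwI[of _ _ _ "\<lambda>x. {i\<in>{..<n}. x i = 1}"])
       (auto simp: cube_def PiE_iff extensional_def fun_eq_iff split: if_splits dest!: bspec)
  have "uniform_cube n = map_pmf ?\<sigma> (pmf_of_set (Pow {..<n}))"
    unfolding uniform_cube_def by (rule map_pmf_of_set_bij_betw[OF bij, symmetric]) auto
  also have "pmf_of_set (Pow {..<n}) =
      map_pmf (\<lambda>b. {i\<in>{..<n}. b i}) (Pi_pmf {..<n} False (\<lambda>_. bernoulli_pmf (1 / 2)))"
    by (rule pmf_of_set_Pow_conv_bernoulli [symmetric]) simp
  finally have "map_pmf (coord_sum n) (uniform_cube n) =
      map_pmf (\<lambda>b. coord_sum n (?\<sigma> {i\<in>{..<n}. b i})) (Pi_pmf {..<n} False (\<lambda>_. bernoulli_pmf (1 / 2)))"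
    by (simp only: pmf.map_comp o_def)
  also have "(\<lambda>b. coord_sum n (?\<sigma> {i\<in>{..<n}. b i})) = (\<lambda>b. 2 * int (card {i\<in>{..<n}. b i}) - int n)"
  proof
    fix b :: "nat \<Rightarrow> bool"
    have "coord_sum n (?\<sigma> {i\<in>{..<n}. b i}) = (\<Sum>i<n. 2 * (if b i then 1 else 0) - 1)"
      unfolding coord_sum_def by (intro sum.cong) auto
    also have "\<dots> = 2 * (\<Sum>i<n. if b i then 1 else 0) - int n"
      by (simp add: sum_subtractf sum_distrib_left)
    also have "(\<Sum>i<n. if b i then 1 else 0) = int (card {i\<in>{..<n}. b i})"
      by (simp add: sum.If_cases Int_def)
    finally show "coord_sum n (?\<sigma> {i\<in>{..<n}. b i}) = 2 * int (card {i\<in>{..<n}. b i}) - int n" .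
  qed
  also have "map_pmf \<dots> (Pi_pmf {..<n} False (\<lambda>_. bernoulli_pmf (1 / 2))) = rademacher_sum n"
    unfolding rademacher_sum_def
    by (subst binomial_pmf_altdef'[of "{..<n}" n _ False]) (simp_all add: pmf.map_comp o_def)
  finally show ?thesis .
qed

text \<open>This is the binomial theorem for the n-th power of (exp(i\<theta>) +
  exp(-i\<theta>))/2.\<close>

lemma char_sum_rademacher_sum: "char_sum (rademacher_sum n) \<theta> = of_real (cos \<theta> ^ n)"
proof -
  have "char_sum (rademacher_sum n) \<theta> =
      (\<Sum>w\<le>n. of_real (real (n choose w) / 2 ^ n) * cis (\<theta> * of_int (2 * int w - int n)))"
    by (simp add: char_sum_def expectation_rademacher_sum scaleR_conv_of_real)
  also have "\<dots> = (\<Sum>w\<le>n. of_nat (n choose w) * (cis \<theta> / 2) ^ w * (cis (- \<theta>) / 2) ^ (n - w))"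
  proof (intro sum.cong refl)
    fix w assume "w \<in> {..n}"
    then have w: "w \<le> n" by simp
    have "cis (\<theta> * of_int (2 * int w - int n)) = cis \<theta> ^ w * cis (- \<theta>) ^ (n - w)"
    proof -
      have "\<theta> * of_int (2 * int w - int n) = real w * \<theta> + real (n - w) * (- \<theta>)"
        using w by (simp add: of_nat_diff algebra_simps)
      then show ?thesis by (simp only: Complex.DeMoivre cis_mult)
    qed
    moreover have "(2::complex) ^ n = 2 ^ w * 2 ^ (n - w)" using w by (simp flip: power_add)
    ultimately show "of_real (real (n choose w) / 2 ^ n) * cis (\<theta> * of_int (2 * int w - int n)) =
        of_nat (n choose w) * (cis \<theta> / 2) ^ w * (cis (- \<theta>) / 2) ^ (n - w)"
      by (simp add: power_divide)
  qed
  also have "\<dots> = (cis \<theta> / 2 + cis (- \<theta>) / 2) ^ n"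
    by (rule binomial_ring [symmetric])
  also have "cis \<theta> / 2 + cis (- \<theta>) / 2 = of_real (cos \<theta>)"
    by (simp add: complex_eq_iff)
  finally show ?thesis by simp
qed

text \<open>Hoeffding's inequality for the binomial count, whose deviation from n/2 is half that of
  the sum.\<close>

lemma prob_rademacher_sum_tail:
  assumes "0 < n"
  shows "measure_pmf.prob (rademacher_sum n) {s. \<bar>s\<bar> > int R} \<le> 2 * exp (- ((real R)\<^sup>2 / (2 * real n)))"
proof -
  interpret binomial_distribution n "1 / 2" by unfold_locales auto
  have "measure_pmf.prob (rademacher_sum n) {s. \<bar>s\<bar> > int R} =
      measure_pmf.prob (binomial_pmf n (1 / 2)) {w. \<bar>2 * int w - int n\<bar> > int R}"
    by (simp add: rademacher_sum_def)
  also have "\<dots> \<le> measure_pmf.prob (binomial_pmf n (1 / 2)) {w. \<bar>real w - real n * (1 / 2)\<bar> \<ge> real R / 2}"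
  proof (intro measure_pmf.finite_measure_mono subsetI)
    fix w assume "w \<in> {w. \<bar>2 * int w - int n\<bar> > int R}"
    then have "real_of_int (int R) < real_of_int \<bar>2 * int w - int n\<bar>" by (simp only: of_int_less_iff mem_Collect_eq)
    then have "real R < \<bar>2 * real w - real n\<bar>" by simp
    then show "w \<in> {w. \<bar>real w - real n * (1 / 2)\<bar> \<ge> real R / 2}" unfolding mem_Collect_eq by argo
  qed simp
  also have "\<dots> \<le> 2 * exp (- 2 * (real R / 2)\<^sup>2 / real n)"
    by (rule prob_abs_ge[OF assms]) simp
  also have "- 2 * (real R / 2)\<^sup>2 / real n = - ((real R)\<^sup>2 / (2 * real n))"
    by (simp add: power2_eq_square)
  finally show ?thesis .
qed

lemma expectation_noise_bit:
  fixes f :: "int \<Rightarrow> 'a :: {banach, second_countable_topology}"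
  assumes "0 \<le> \<rho>" "\<rho> \<le> 1"
  shows "measure_pmf.expectation (noise_bit \<rho>) f = ((1 - \<rho>) / 2) *\<^sub>R (f (- 1) + f 1) + \<rho> *\<^sub>R f 1"
proof -
  have "measure_pmf.expectation (pmf_of_set {- 1, 1}) f = (1 / 2) *\<^sub>R (f (- 1) + f 1)"
    by (subst integral_measure_pmf[of "{- 1, 1}"]) (auto simp: scaleR_add_right)
  then show ?thesis
    unfolding noise_bit_def using assms
    by (subst pmf_expectation_bind[of UNIV]) (auto simp: UNIV_bool)
qed

text \<open>On the noisy side one sees $\cos\theta + i\rho x\sin\theta$ per coordinate, which has the same argument as
  $e^{i \varphi x}$ for $\tan\varphi = \rho\tan\theta$.\<close>

lemma char_sum_noise:
  assumes D: "set_pmf D \<subseteq> cube n" and \<rho>: "0 < \<rho>" "\<rho> \<le> 1"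
    and tan: "\<rho> * (sin \<theta> * cos \<phi>) = sin \<phi> * cos \<theta>"
  shows "of_real (cos \<phi> ^ n) * char_sum (map_pmf (coord_sum n) (cube_mult n D (noise n \<rho>))) \<theta> =
    of_real (cos \<theta> ^ n) * char_sum (map_pmf (coord_sum n) D) \<phi>"
proof -
  have finD: "finite (set_pmf D)"
    using D by (rule finite_subset) (simp add: cube_def finite_PiE)
  have finb: "finite (set_pmf (noise_bit \<rho>))"
    by (auto simp: noise_bit_def)
  have finN: "finite (set_pmf (noise n \<rho>))"
    unfolding noise_def using finb by (subst set_Pi_pmf) (auto intro!: finite_PiE_dflt)
  have cube_mult: "cube_mult n D (noise n \<rho>) =
      D \<bind> (\<lambda>x. map_pmf (\<lambda>y. \<lambda>i\<in>{..<n}. x i * y i) (noise n \<rho>))"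
    by (simp add: cube_mult_def pair_pmf_def map_pmf_def bind_assoc_pmf bind_return_pmf)
  have point: "of_real (cos \<phi> ^ n) * measure_pmf.expectation (noise n \<rho>) (\<lambda>y. cis (\<theta> * of_int (\<Sum>i<n. x i * y i)))
      = of_real (cos \<theta> ^ n) * cis (\<phi> * of_int (coord_sum n x))" if x: "x \<in> set_pmf D" for x
  proof -
    have cis_sum: "cis (\<alpha> * of_int (\<Sum>i<n. z i)) = (\<Prod>i<n. cis (\<alpha> * of_int (z i)))" for \<alpha> and z :: "nat \<Rightarrow> int"
      by (simp add: sum_distrib_left cis_conv_exp exp_sum algebra_simps)
    have "measure_pmf.expectation (noise n \<rho>) (\<lambda>y. cis (\<theta> * of_int (\<Sum>i<n. x i * y i))) =
        measure_pmf.expectation (noise n \<rho>) (\<lambda>y. \<Prod>i<n. cis (\<theta> * of_int (x i * y i)))"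
      by (simp only: cis_sum)
    also have "\<dots> = (\<Prod>i<n. measure_pmf.expectation (noise_bit \<rho>) (\<lambda>b. cis (\<theta> * of_int (x i * b))))"
      unfolding noise_def by (rule expectation_prod_Pi_pmf_finite) (use finb in auto)
    finally have "of_real (cos \<phi> ^ n) * measure_pmf.expectation (noise n \<rho>) (\<lambda>y. cis (\<theta> * of_int (\<Sum>i<n. x i * y i)))
        = (\<Prod>i<n. of_real (cos \<phi>) * measure_pmf.expectation (noise_bit \<rho>) (\<lambda>b. cis (\<theta> * of_int (x i * b))))"
      by (simp add: prod.distrib)
    \<comment> \<open>By independence only one coordinate is left: cos \<phi> (cos \<theta> +
      i\<rho>x sin \<theta>) = cos \<theta> exp(i\<phi>x) for x = 1 or -1. The real parts agree, and
      the imaginary parts agree by the hypothesis \<open>tan\<close>.\<close>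
    also have "\<dots> = (\<Prod>i<n. of_real (cos \<theta>) * cis (\<phi> * of_int (x i)))"
    proof (intro prod.cong refl)
      fix i assume "i \<in> {..<n}"
      then have "x i = 1 \<or> x i = - 1" using x D by (auto simp: cube_def PiE_iff)
      then show "of_real (cos \<phi>) * measure_pmf.expectation (noise_bit \<rho>) (\<lambda>b. cis (\<theta> * of_int (x i * b))) =
          of_real (cos \<theta>) * cis (\<phi> * of_int (x i))"
        using tan \<rho> by (auto simp: expectation_noise_bit complex_eq_iff algebra_simps)
    qed
    also have "\<dots> = of_real (cos \<theta> ^ n) * cis (\<phi> * of_int (coord_sum n x))"
      by (simp add: prod.distrib coord_sum_def cis_sum del: of_int_sum)
    finally show ?thesis .
  qed
  have coord: "coord_sum n (\<lambda>i\<in>{..<n}. x i * y i) = (\<Sum>i<n. x i * y i)" for x y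
    by (simp add: coord_sum_def)
  have "char_sum (map_pmf (coord_sum n) (cube_mult n D (noise n \<rho>))) \<theta> =
      (\<Sum>x\<in>set_pmf D. pmf D x *\<^sub>R measure_pmf.expectation (noise n \<rho>) (\<lambda>y. cis (\<theta> * of_int (\<Sum>i<n. x i * y i))))"
    unfolding char_sum_def integral_map_pmf cube_mult
    by (subst pmf_expectation_bind[of "set_pmf D"]) (use finD finN in \<open>auto simp only: integral_map_pmf coord set_map_pmf finite_imageI\<close>)
  then have "of_real (cos \<phi> ^ n) * char_sum (map_pmf (coord_sum n) (cube_mult n D (noise n \<rho>))) \<theta> =
      (\<Sum>x\<in>set_pmf D. pmf D x *\<^sub>R (of_real (cos \<theta> ^ n) * cis (\<phi> * of_int (coord_sum n x))))"
    by (simp add: sum_distrib_left point del: of_real_power of_int_sum of_int_mult)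
  also have "\<dots> = of_real (cos \<theta> ^ n) * char_sum (map_pmf (coord_sum n) D) \<phi>"
    unfolding char_sum_def integral_map_pmf
    by (subst integral_measure_pmf[of "set_pmf D"]) (use finD in \<open>auto simp: sum_distrib_left\<close>)
  finally show ?thesis .
qed

section \<open>The lower bound on the distance\<close>

lemma abs_arctan_le: "\<bar>arctan x\<bar> \<le> \<bar>x\<bar>"
proof -
  have "\<bar>arctan x\<bar> < pi / 2" using arctan_lbound[of x] arctan_ubound[of x] by linarith
  from abs_tan_ge[OF this] show ?thesis by (simp add: tan_arctan)
qed

text \<open>With $\tan\varphi = \rho\tan\theta$ one has
  $\cos^2\varphi / \cos^2\theta = \cos^2\varphi + \sin^2\varphi / \rho^2$.\<close>

lemma ex_noise_angle:
  fixes \<rho> \<phi> :: real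
  assumes \<rho>: "0 < \<rho>" "\<rho> \<le> 1" and \<phi>: "\<bar>\<phi>\<bar> \<le> 1"
  obtains \<theta> where "\<rho> * (sin \<theta> * cos \<phi>) = sin \<phi> * cos \<theta>" "0 < cos \<theta>" "0 < cos \<phi>"
    "\<bar>\<theta>\<bar> \<le> 2 * \<bar>\<phi>\<bar> / \<rho>" "cos \<phi> / cos \<theta> \<le> exp (\<phi>\<^sup>2 / (2 * \<rho>\<^sup>2))"
proof
  define \<theta> where "\<theta> = arctan (tan \<phi> / \<rho>)"
  have c: "1 / 2 \<le> cos \<phi>" using cos_ge_half[OF \<phi>] .
  have tan: "tan \<theta> = tan \<phi> / \<rho>" by (simp add: \<theta>_def tan_arctan)
  show c\<theta>: "0 < cos \<theta>"
    unfolding \<theta>_def by (intro cos_gt_zero_pi arctan_lbound arctan_ubound)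
  show c\<phi>: "0 < cos \<phi>" using c by simp
  show "\<rho> * (sin \<theta> * cos \<phi>) = sin \<phi> * cos \<theta>"
    using tan c\<theta> c\<phi> \<rho> by (simp add: tan_def field_simps)
  have "\<bar>tan \<phi>\<bar> \<le> 2 * \<bar>\<phi>\<bar>"
  proof -
    have "\<bar>sin \<phi>\<bar> \<le> \<bar>\<phi>\<bar>" by (rule abs_sin_x_le_abs_x)
    also have "\<bar>\<phi>\<bar> * 1 \<le> \<bar>\<phi>\<bar> * (2 * cos \<phi>)" using c by (intro mult_left_mono) auto
    finally show ?thesis using c\<phi> by (simp add: tan_def field_simps)
  qed
  then have "\<bar>tan \<phi> / \<rho>\<bar> \<le> 2 * \<bar>\<phi>\<bar> / \<rho>" using \<rho> by (simp add: divide_right_mono)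
  then show "\<bar>\<theta>\<bar> \<le> 2 * \<bar>\<phi>\<bar> / \<rho>"
    using abs_arctan_le[of "tan \<phi> / \<rho>"] unfolding \<theta>_def by linarith
  have "(cos \<phi> / cos \<theta>)\<^sup>2 = (cos \<phi>)\<^sup>2 * (1 + (tan \<theta>)\<^sup>2)"
    using tan_sec[of \<theta>] c\<theta> by (simp add: power_divide power_inverse divide_inverse power_mult_distrib)
  also have "\<dots> = (cos \<phi>)\<^sup>2 + (sin \<phi>)\<^sup>2 / \<rho>\<^sup>2"
    unfolding tan using c\<phi> \<rho> by (simp add: tan_def power_divide field_simps)
  also have "\<dots> \<le> 1 + \<phi>\<^sup>2 / \<rho>\<^sup>2"
  proof -
    have "(sin \<phi>)\<^sup>2 \<le> \<phi>\<^sup>2" using abs_sin_x_le_abs_x[of \<phi>] by (rule abs_le_square_iff[THEN iffD1])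
    moreover have "(cos \<phi>)\<^sup>2 \<le> 1" by (simp add: abs_square_le_1)
    ultimately show ?thesis by (intro add_mono divide_right_mono) auto
  qed
  also have "\<dots> \<le> exp (\<phi>\<^sup>2 / \<rho>\<^sup>2)" by (rule exp_ge_add_one_self)
  also have "\<dots> = (exp (\<phi>\<^sup>2 / (2 * \<rho>\<^sup>2)))\<^sup>2"
    by (simp add: exp_double [symmetric])
  finally show "cos \<phi> / cos \<theta> \<le> exp (\<phi>\<^sup>2 / (2 * \<rho>\<^sup>2))"
    by (rule power2_le_imp_le) simp
qed

text \<open>With K = k/\<rho>, the expectation of the test function \<open>H\<close> under
  \<open>B\<close> lies between exp(-100K) and 4^k times the largest difference of characteristic
  functions at frequencies up to kh. The latter is linear in \<delta> apart from a tail of order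
  exp(-128K), too small to account for the lower bound.\<close>

lemma threshold_distance_ge:
  fixes D :: "(nat \<Rightarrow> int) pmf" and n k :: nat and \<rho> :: real
  defines "q \<equiv> map_pmf (coord_sum n) (cube_mult n D (noise n \<rho>))"
  assumes D: "set_pmf D \<subseteq> cube n" and k: "card (coord_sum n ` set_pmf D) = k" "0 < k" "k \<le> n"
    and \<rho>: "0 < \<rho>" "\<rho> \<le> 1"
    and close: "\<And>r. \<bar>measure_pmf.prob (rademacher_sum n) {s. s \<ge> r} - measure_pmf.prob q {s. s \<ge> r}\<bar> \<le> \<delta>"
  shows "exp (- 112 * (real k / \<rho>)) \<le> \<delta>"
proof -
  define B where "B = rademacher_sum n"
  define d where "d = map_pmf (coord_sum n) D"
  define J where "J = set_pmf d"
  define K where "K = real k / \<rho>"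
  define h where "h = sqrt (\<rho> / (real n * real k)) / 2"
  \<comment> \<open>The factor 16 gives Hoeffding exponent 16^2 / 2 = 128, beyond the 100 of the
    lower bound plus later losses. With |\<theta>| \<le> sqrt(K/n), R|\<theta>| remains at most
    32K.\<close>
  define R where "R = nat \<lceil>16 * sqrt (real n * K)\<rceil>"
  define H where "H s = (\<Prod>j\<in>J. 2 - 2 * cos (h * of_int (s - j)))" for s :: int
  have n: "0 < n" using k by simp
  have kK: "real k \<le> K"
    using \<rho> by (simp add: K_def pos_le_divide_eq mult_left_le)
  have K1: "1 \<le> K" using k kK by linarith
  have finD: "finite (set_pmf D)"
    using D by (rule finite_subset) (simp add: cube_def finite_PiE)
  then have J: "finite J" "card J = k" using k by (simp_all add: J_def d_def)
  have h0: "0 \<le> h" using \<rho> by (simp add: h_def)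
  have kh: "real k * h = sqrt (real k * \<rho> / real n) / 2"
    using k by (simp add: h_def real_sqrt_divide real_sqrt_mult field_simps)
  have kh1: "real k * h \<le> 1"
  proof -
    have "real k * \<rho> \<le> real n * 1" using k \<rho> by (intro mult_mono) auto
    then have "sqrt (real k * \<rho> / real n) \<le> sqrt 1" using n by (intro real_sqrt_le_mono) simp
    then show ?thesis unfolding kh real_sqrt_one by linarith
  qed
  have \<delta>0: "0 \<le> \<delta>" using close[of 0] by linarith

  have R: "16 * sqrt (real n * K) \<le> real R" "real R \<le> 32 * sqrt (real n * K)"
  proof -
    show "16 * sqrt (real n * K) \<le> real R" unfolding R_def by (rule real_nat_ceiling_ge)
    have "1 * 1 \<le> real n * K" using n K1 by (intro mult_mono) auto
    then have "1 \<le> sqrt (real n * K)" by simp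
    moreover have "real R \<le> 16 * sqrt (real n * K) + 1"
      using K1 by (simp add: R_def)
    ultimately show "real R \<le> 32 * sqrt (real n * K)" by linarith
  qed
  have tail: "measure_pmf.prob B {s. \<bar>s\<bar> > int R} \<le> 2 * exp (- 128 * K)"
  proof -
    have "(16 * sqrt (real n * K))\<^sup>2 \<le> (real R)\<^sup>2" using R K1 by (intro power_mono) auto
    then have "128 * K \<le> (real R)\<^sup>2 / (2 * real n)" using n K1 by (simp add: power_mult_distrib field_simps)
    then have "exp (- ((real R)\<^sup>2 / (2 * real n))) \<le> exp (- 128 * K)" by simp
    then show ?thesis using prob_rademacher_sum_tail[OF n, of R] unfolding B_def by linarith
  qed

  \<comment> \<open>\<open>exp K\<close> bounds the amplification in passing from \<theta> to
    \<phi>; 64K is twice the bound on R|\<theta>|, and 8 is 4 times the factor 2 in the tail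
    bound.\<close>
  define X where "X = exp K * (\<delta> * (64 * K + 4) + 8 * exp (- 128 * K))"
  have X0: "0 \<le> \<delta> * (64 * K + 4) + 8 * exp (- 128 * K)" using \<delta>0 K1 by (intro add_nonneg_nonneg mult_nonneg_nonneg) auto
  have char: "norm (char_sum B \<phi> - char_sum d \<phi>) \<le> X" if \<phi>: "\<bar>\<phi>\<bar> \<le> real k * h" for \<phi>
  proof -
    have "\<bar>\<phi>\<bar> \<le> 1" using \<phi> kh1 by linarith
    then obtain \<theta> where \<theta>: "\<rho> * (sin \<theta> * cos \<phi>) = sin \<phi> * cos \<theta>" "0 < cos \<theta>" "0 < cos \<phi>"
      "\<bar>\<theta>\<bar> \<le> 2 * \<bar>\<phi>\<bar> / \<rho>" "cos \<phi> / cos \<theta> \<le> exp (\<phi>\<^sup>2 / (2 * \<rho>\<^sup>2))"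
      using ex_noise_angle[OF \<rho>] by blast
    \<comment> \<open>As cos^n is the characteristic function of \<open>B\<close>, \<open>B\<close>
      satisfies the same relation as \<open>d\<close> and \<open>q\<close> with itself on both
      sides. Hence the relation passes to differences.\<close>
    have "of_real (cos \<theta> ^ n) * (char_sum B \<phi> - char_sum d \<phi>) = of_real (cos \<phi> ^ n) * (char_sum B \<theta> - char_sum q \<theta>)"
      using char_sum_noise[OF D \<rho> \<theta>(1)] unfolding B_def d_def q_def
      by (simp add: char_sum_rademacher_sum right_diff_distrib mult.commute)
    then have "norm (of_real (cos \<theta> ^ n) * (char_sum B \<phi> - char_sum d \<phi>)) = norm (of_real (cos \<phi> ^ n) * (char_sum B \<theta> - char_sum q \<theta>))"
      by (simp only:)
    then have "cos \<theta> ^ n * norm (char_sum B \<phi> - char_sum d \<phi>) = cos \<phi> ^ n * norm (char_sum B \<theta> - char_sum q \<theta>)"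
      using \<theta> by (simp add: norm_mult norm_power)
    then have eq: "norm (char_sum B \<phi> - char_sum d \<phi>) = (cos \<phi> / cos \<theta>) ^ n * norm (char_sum B \<theta> - char_sum q \<theta>)"
      using \<theta> by (simp add: power_divide field_simps)
    \<comment> \<open>The choice of \<open>h\<close> gives |\<phi>| \<le> sqrt(k\<rho>/n) / 2, which
      keeps the exponent n\<phi>^2 / (2\<rho>^2) at most K/8.\<close>
    have "(cos \<phi> / cos \<theta>) ^ n \<le> exp (\<phi>\<^sup>2 / (2 * \<rho>\<^sup>2)) ^ n"
      using \<theta> by (intro power_mono) auto
    also have "\<dots> = exp (real n * (\<phi>\<^sup>2 / (2 * \<rho>\<^sup>2)))" by (simp only: exp_of_nat_mult)
    also have "\<dots> \<le> exp K"
    proof -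
      have "\<bar>\<phi>\<bar>\<^sup>2 \<le> (real k * h)\<^sup>2" using \<phi> by (intro power_mono) auto
      then have "\<phi>\<^sup>2 \<le> real k * \<rho> / real n / 4" unfolding kh using \<rho> by (simp add: power_divide)
      then have "real n * (\<phi>\<^sup>2 / (2 * \<rho>\<^sup>2)) \<le> real n * ((real k * \<rho> / real n / 4) / (2 * \<rho>\<^sup>2))"
        by (intro mult_left_mono divide_right_mono) auto
      also have "\<dots> = K / 8" using n \<rho> by (simp add: K_def power2_eq_square)
      also have "\<dots> \<le> K" using K1 by simp
      finally show ?thesis by simp
    qed
    finally have amp: "(cos \<phi> / cos \<theta>) ^ n \<le> exp K" .
    have "\<bar>\<theta>\<bar> \<le> sqrt (K / real n)"
    proof -
      have "2 * \<bar>\<phi>\<bar> / \<rho> \<le> sqrt (real k * \<rho> / real n) / \<rho>"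
        using \<phi> \<rho> unfolding kh by (intro divide_right_mono) auto
      also have "\<dots> = sqrt (K / real n)"
        using n \<rho> by (simp add: K_def real_sqrt_divide real_sqrt_mult field_simps)
      finally show ?thesis using \<theta>(4) by linarith
    qed
    then have "real R * \<bar>\<theta>\<bar> \<le> 32 * sqrt (real n * K) * sqrt (K / real n)"
      using R K1 by (intro mult_mono) auto
    also have "\<dots> = 32 * sqrt (K * K)" using n by (simp add: real_sqrt_mult [symmetric])
    also have "\<dots> = 32 * K" using K1 by simp
    finally have "\<delta> * (2 * real R * \<bar>\<theta>\<bar> + 4) \<le> \<delta> * (64 * K + 4)"
      using \<delta>0 by (intro mult_left_mono) (auto simp: mult.commute)
    moreover have "norm (char_sum B \<theta> - char_sum q \<theta>)
        \<le> \<delta> * (2 * real R * \<bar>\<theta>\<bar> + 4) + 4 * measure_pmf.prob B {s. \<bar>s\<bar> > int R}"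
      unfolding B_def by (rule norm_char_sum_diff_le[OF close])
    ultimately have "norm (char_sum B \<theta> - char_sum q \<theta>) \<le> \<delta> * (64 * K + 4) + 8 * exp (- 128 * K)"
      using tail by linarith
    then show ?thesis
      unfolding eq X_def using amp by (intro mult_mono) auto
  qed

  have "exp (- 100 * K) \<le> measure_pmf.expectation B H"
    using expectation_prod_cos_ge[OF J k(2,3) \<rho>] unfolding B_def H_def [abs_def] h_def K_def by simp
  also have "\<dots> \<le> 4 ^ k * X"
  proof -
    have finB: "finite (set_pmf B)" by (auto simp: B_def rademacher_sum_def)
    \<comment> \<open>The factor with j = s is 2 - 2 cos 0.\<close>
    have Hd: "H s = 0" if "s \<in> J" for s
      using that J by (auto simp: H_def intro!: bexI[of _ s])
    have "measure_pmf.expectation d H = measure_pmf.expectation d (\<lambda>s. 0)"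
      by (intro integral_cong_AE) (auto simp: AE_measure_pmf_iff Hd J_def [symmetric])
    then have Ed: "measure_pmf.expectation d H = 0" by simp
    \<comment> \<open>Frequency 0 leaves \<open>H\<close> itself, and the k shifts by
      \<open>h\<close> use up exactly the range on which \<open>char\<close> holds.\<close>
    have "norm (measure_pmf.expectation B (\<lambda>s. cis (0 * of_int s) * complex_of_real (H s))
        - measure_pmf.expectation d (\<lambda>s. cis (0 * of_int s) * complex_of_real (H s))) \<le> 4 ^ card J * X"
      unfolding H_def
      by (rule norm_expectation_diff_prod_le[where M = "real k * h"])
         (use finB J char h0 in \<open>auto simp: J_def\<close>)
    then have "norm (complex_of_real (measure_pmf.expectation B H)) \<le> 4 ^ k * X"
      using J by (simp add: Ed)
    then show ?thesis by simp
  qed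
  finally have main: "exp (- 100 * K) \<le> 4 ^ k * X" .

  have e2: "2 \<le> exp (1::real)" using exp_ge_add_one_self[of 1] by simp
  have pow: "2 ^ m \<le> exp (real m * K)" for m
  proof -
    have "2 ^ m \<le> exp K ^ m"
      using e2 K1 by (intro power_mono) (auto intro: order_trans)
    then show ?thesis by (simp add: exp_of_nat_mult)
  qed
  have "(4::real) ^ k = 2 ^ (2 * k)" by (simp add: power_mult)
  also have "\<dots> \<le> exp 1 ^ (2 * k)" using e2 by (intro power_mono) auto
  also have "\<dots> = exp (2 * real k)" by (simp flip: exp_of_nat_mult)
  also have "\<dots> \<le> exp (2 * K)" using kK by simp
  finally have "4 ^ k * X \<le> exp (2 * K) * X"
    using X0 by (intro mult_right_mono) (auto simp: X_def)
  also have "\<dots> = exp (3 * K) * (\<delta> * (64 * K + 4)) + 8 * exp (- 125 * K)"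
    by (simp add: X_def distrib_left exp_add [symmetric] mult.assoc [symmetric])
  also have "\<dots> \<le> exp (3 * K) * (\<delta> * exp (8 * K)) + exp (- 101 * K)"
  proof (intro add_mono mult_left_mono)
    have "64 * K + 4 \<le> 2 ^ 7 * K" using K1 by simp
    also have "\<dots> \<le> 2 ^ 7 * exp K" using exp_ge_add_one_self[of K] by (intro mult_left_mono, linarith) simp
    also have "\<dots> \<le> exp (7 * K) * exp K" using pow[of 7] by simp
    also have "\<dots> = exp (8 * K)" by (simp add: exp_add [symmetric])
    finally show "64 * K + 4 \<le> exp (8 * K)" .
    have "8 * exp (- 125 * K) \<le> exp (3 * K) * exp (- 125 * K)"
      using pow[of 3] by (intro mult_right_mono) auto
    also have "\<dots> \<le> exp (- 101 * K)" using K1 by (simp add: exp_add [symmetric])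
    finally show "8 * exp (- 125 * K) \<le> exp (- 101 * K)" .
  qed (use \<delta>0 in auto)
  finally have "exp (- 100 * K) \<le> exp (11 * K) * \<delta> + exp (- 101 * K)"
    using main by (simp add: exp_add [symmetric] mult_ac)
  \<comment> \<open>The tail term is at most half of the lower bound, as exp K \<ge> 2. The other
    half yields exp(-101K) \<le> exp(11K) \<delta>, whence 112 = 101 + 11.\<close>
  moreover have "2 * exp (- 101 * K) \<le> exp (- 100 * K)"
    using mult_right_mono[OF pow[of 1], of "exp (- 101 * K)"] by (simp add: exp_add [symmetric])
  ultimately have "exp (- 101 * K) \<le> exp (11 * K) * \<delta>" by linarith
  then have "exp (- 11 * K) * exp (- 101 * K) \<le> exp (- 11 * K) * (exp (11 * K) * \<delta>)"
    by (intro mult_left_mono) auto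
  then show ?thesis
    unfolding K_def [symmetric] by (simp add: exp_add [symmetric] mult.assoc [symmetric])
qed

theorem mainTheorem9:
  "\<exists>c::real. c > 0 \<and>
     (\<forall>(n::nat) (k::nat) (D :: (nat \<Rightarrow> int) pmf) (\<rho>::real).
        set_pmf D \<subseteq> cube n \<longrightarrow>
        card (coord_sum n ` set_pmf D) \<le> k \<longrightarrow> k \<le> n \<longrightarrow>
        0 < \<rho> \<longrightarrow> \<rho> \<le> 1 \<longrightarrow>
        (\<exists>t::real.
           \<bar>measure_pmf.prob (uniform_cube n) {x. real_of_int (coord_sum n x) \<ge> t}
            - measure_pmf.prob (cube_mult n D (noise n \<rho>)) {x. real_of_int (coord_sum n x) \<ge> t}\<bar>
           \<ge> 2 powr (- (c * real k / \<rho>))))"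
\<comment> \<open>Division by ln 2 converts base 2 to base e. Taking 113 rather than 112 makes the
  comparison strict, so closeness up to \<delta> becomes contradictory.\<close>
proof (rule exI[of _ "113 / ln 2"], intro conjI allI impI)
  fix n k :: nat and D :: "(nat \<Rightarrow> int) pmf" and \<rho> :: real
  assume D: "set_pmf D \<subseteq> cube n" and card: "card (coord_sum n ` set_pmf D) \<le> k" "k \<le> n"
    and \<rho>: "0 < \<rho>" "\<rho> \<le> 1"
  \<comment> \<open>\<open>m\<close> is the exact number of values, as the distance bound requires;
    it is positive because the support of a distribution is nonempty.\<close>
  define m where "m = card (coord_sum n ` set_pmf D)"
  define \<delta> where "\<delta> = 2 powr (- (113 / ln 2 * real k / \<rho>))"
  have "finite (set_pmf D)"
    using D by (rule finite_subset) (simp add: cube_def finite_PiE)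
  then have m: "0 < m" by (simp add: m_def card_gt_0_iff set_pmf_not_empty)
  have "\<delta> = exp (- 113 * (real k / \<rho>))"
    by (simp add: \<delta>_def powr_def)
  also have "\<dots> < exp (- 112 * (real m / \<rho>))"
  proof -
    have "real m / \<rho> \<le> real k / \<rho>" using card \<rho> by (intro divide_right_mono) (auto simp: m_def)
    moreover have "0 < real m / \<rho>" using m \<rho> by simp
    ultimately show ?thesis by simp
  qed
  finally have small: "\<delta> < exp (- 112 * (real m / \<rho>))" .
  show "\<exists>t::real.
           \<bar>measure_pmf.prob (uniform_cube n) {x. real_of_int (coord_sum n x) \<ge> t}
            - measure_pmf.prob (cube_mult n D (noise n \<rho>)) {x. real_of_int (coord_sum n x) \<ge> t}\<bar>
           \<ge> 2 powr (- (113 / ln 2 * real k / \<rho>))"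
  proof (rule ccontr)
    assume neg: "\<not> ?thesis"
    \<comment> \<open>Integer thresholds are instances of the real threshold t, and both laws on the
      cube are pushed forward along \<open>coord_sum n\<close>.\<close>
    have "\<bar>measure_pmf.prob (rademacher_sum n) {s. s \<ge> r} -
        measure_pmf.prob (map_pmf (coord_sum n) (cube_mult n D (noise n \<rho>))) {s. s \<ge> r}\<bar> \<le> \<delta>" for r
      using neg unfolding \<delta>_def map_coord_sum_uniform_cube [symmetric]
      by (auto simp: vimage_def not_le dest!: spec[of _ "real_of_int r"])
    then have "exp (- 112 * (real m / \<rho>)) \<le> \<delta>"
      using card by (intro threshold_distance_ge[OF D m_def[symmetric] m _ \<rho>]) (auto simp: m_def)
    then show False using small by simp
  qed
qed simp

end
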